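(* Let $p,q\geq 1$ and $\underline{s}\in S^{q-1}$. Among functions of the form $$F(\underline{x},\langle\underline{y},\underline{s}\rangle)=\sum_{j=0}^\infty \underline{x}^j (c_j +\underline{s}\,d_j)e^{\langle\underline{y},\underline{s}\rangle},\qquad (\underline{x},\underline{y})\in\mathbb{R}^p\times\mathbb{R}^q,$$ with complex constants $c_j,d_j$ and initial condition $c_0=1$, $d_0=0$, the hypermonogenic plane wave (i.e. the one satisfying $(\partial_{\underline{x}}+\partial_{\underline{y}})F=0$) is $$F(\underline{x},\langle\underline{y},\underline{s}\rangle)=\frac{2^{\frac{p}{2}-1}\Gamma(\frac{p}{2})}{|\underline{x}|^{\frac{p}{2}-1}}\Big(J_{\frac{p}{2}-1}(|\underline{x}|) +J_{\frac{p}{2}}(|\underline{x}|) \frac{\underline{x}}{|\underline{x}|}\underline{s}\Big)e^{\langle\underline{y},\underline{s}\rangle},$$ where the right-hand side is understood by continuous extension at $\underline{x}=\underline{0}$.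
   Context: $\mathbb{C}_{p+q}$ is the complex Clifford algebra with generators $e_1,\dots,e_{p+q}$ satisfying $e_ie_j+e_je_i=-2\delta_{ij}$. Vectors $\underline{x}\in\mathbb{R}^p$ and $\underline{y},\underline{s}\in\mathbb{R}^q$ are embedded as $\underline{x}=\sum_{j=1}^p x_je_j$, $\underline{y}=\sum_{j=1}^q y_je_{p+j}$, $\underline{s}=\sum_{j=1}^q s_je_{p+j}$; powers and products are taken in $\mathbb{C}_{p+q}$. $\langle\cdot,\cdot\rangle$ is the Euclidean inner product, $S^{q-1}$ the unit sphere of $\mathbb{R}^q$. $\partial_{\underline{x}}=\sum_{j=1}^p e_j\partial_{x_j}$, $\partial_{\underline{y}}=\sum_{j=1}^q e_{p+j}\partial_{y_j}$. A function of the form $\sum_{j=0}^\infty \underline{x}^j (C_j(\langle\underline{y},\underline{s}\rangle)+\underline{s}D_j(\langle\underline{y},\underline{s}\rangle))$, with $C_j,D_j$ complex-valued differentiable functions, is a hypermonogenic plane wave if it is annihilated by $\partial_{\underline{x}}+\partial_{\underline{y}}$. $J_\nu$ is the Bessel function $J_{\nu}(z)=\frac{z^\nu}{2^\nu}\sum_{j=0}^\infty\frac{(-1)^j z^{2j}}{j!\, 2^{2j}\,\Gamma(\nu+j+1)}$. *)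

theory Defs
  imports "HOL-Analysis.Analysis"
begin

section \<open>The complex Clifford algebra\<close>

text \<open>
  \<open>'n clifford\<close> is the complex Clifford algebra with one generator \<open>e\<^sub>i\<close> for each element \<open>i\<close> of the
  finite index type \<open>'n\<close> and relations \<open>e\<^sub>i e\<^sub>j + e\<^sub>j e\<^sub>i = -2 \<delta>\<^sub>i\<^sub>j\<close>.  An element is given by its
  complex coefficients with respect to the basis \<open>e\<^sub>A\<close> (\<open>A\<close> ranging over the sets of
  indices), where \<open>e\<^sub>A\<close> is the product of the \<open>e\<^sub>i\<close> with \<open>i \<in> A\<close> in increasing order.  The order
  on the indices is the one induced by the injection \<open>to_nat\<close>; the choice of order only affects
  the signs of the basis elements, not the algebra generated by the \<open>e\<^sub>i\<close>.
\<close>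

typedef 'n clifford = "UNIV :: (complex ^ ('n::finite) set) set"
  morphisms coeffs Clifford by simp

abbreviation blade_coeff :: "'n::finite clifford \<Rightarrow> 'n set \<Rightarrow> complex"
  where "blade_coeff x A \<equiv> coeffs x $ A"

text \<open>
  The sign in \<open>e\<^sub>A e\<^sub>B = blade_sign A B e\<^sub>C\<close>, where \<open>C\<close> is the symmetric difference of \<open>A\<close> and \<open>B\<close>:
  each \<open>j \<in> B\<close> passes all the strictly larger \<open>i \<in> A\<close>, and contributes a
  further \<open>e\<^sub>j e\<^sub>j = -1\<close> if \<open>j \<in> A\<close>.
\<close>

definition blade_sign :: "'n::finite set \<Rightarrow> 'n set \<Rightarrow> complex"
  where "blade_sign A B = (\<Prod>i\<in>A. \<Prod>j\<in>B. if to_nat j \<le> to_nat i then -1 else 1)"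

lemma clifford_eq_iff: "x = y \<longleftrightarrow> (\<forall>A. blade_coeff x A = blade_coeff y A)"
  by (metis coeffs_inject vec_eq_iff)

lemma coeff_Clifford [simp]: "coeffs (Clifford v) = v"
  by (simp add: Clifford_inverse)

instantiation clifford :: (finite) real_vector
begin
definition "0 = Clifford 0"
definition "x + y = Clifford (coeffs x + coeffs y)"
definition "- x = Clifford (- coeffs x)"
definition "x - y = Clifford (coeffs x - coeffs y)"
definition "r *\<^sub>R x = Clifford (r *\<^sub>R coeffs x)"
instance
  by standard (auto simp: clifford_eq_iff zero_clifford_def plus_clifford_def uminus_clifford_def
      minus_clifford_def scaleR_clifford_def algebra_simps)
end

lemma coeffs_linear_simps [simp]:
  "coeffs (0 :: 'n::finite clifford) = 0"
  "coeffs (x + y :: 'n clifford) = coeffs x + coeffs y"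
  "coeffs (- x) = - coeffs x"
  "coeffs (x - y) = coeffs x - coeffs y"
  "coeffs (r *\<^sub>R x) = r *\<^sub>R coeffs x"
  by (simp_all add: zero_clifford_def plus_clifford_def uminus_clifford_def
      minus_clifford_def scaleR_clifford_def)

instantiation clifford :: (finite) real_normed_vector
begin
definition norm_clifford_def: "norm x = norm (coeffs x)" for x :: "'a clifford"
definition dist_clifford_def: "dist x y = norm (coeffs x - coeffs y)" for x y :: "'a clifford"
definition sgn_clifford_def: "sgn x = x /\<^sub>R norm x" for x :: "'a clifford"
definition uniformity_clifford_def:
  "(uniformity :: ('a clifford \<times> 'a clifford) filter) =
    (INF e\<in>{0<..}. principal {(x, y). dist x y < e})"
definition open_clifford_def:
  "open U \<longleftrightarrow> (\<forall>x\<in>U. \<forall>\<^sub>F (x', y) in uniformity. x' = x \<longrightarrow> y \<in> U)"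
  for U :: "'a clifford set"
instance
proof
  fix x y :: "'a clifford" and r :: real
  show "dist x y = norm (x - y)"
    by (simp add: dist_clifford_def norm_clifford_def)
  show "sgn x = x /\<^sub>R norm x"
    by (fact sgn_clifford_def)
  show "norm x = 0 \<longleftrightarrow> x = 0"
    by (metis norm_clifford_def norm_eq_zero coeffs_inject coeffs_linear_simps(1))
  show "norm (x + y) \<le> norm x + norm y"
    by (simp add: norm_clifford_def norm_triangle_ineq)
  show "norm (r *\<^sub>R x) = \<bar>r\<bar> * norm x"
    by (simp add: norm_clifford_def)
qed (fact uniformity_clifford_def open_clifford_def)+
end

lemma prod_sym_diff:
  fixes f :: "'a \<Rightarrow> 'b::comm_ring_1"
  assumes "finite A" "finite B" "\<And>i. f i * f i = 1"
  shows "prod f (sym_diff A B) = prod f A * prod f B"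
proof -
  have A: "prod f A = prod f (A - B) * prod f (A \<inter> B)"
    by (subst prod.union_disjoint [symmetric]) (auto simp: assms intro!: prod.cong)
  have B: "prod f B = prod f (B - A) * prod f (A \<inter> B)"
    by (subst prod.union_disjoint [symmetric]) (auto simp: assms intro!: prod.cong)
  have I: "prod f (A \<inter> B) * prod f (A \<inter> B) = 1"
    by (simp add: prod.distrib [symmetric] assms)
  have "prod f (sym_diff A B) = prod f (A - B) * prod f (B - A)"
    by (rule prod.union_disjoint) (auto simp: assms)
  also have "\<dots> = prod f (A - B) * prod f (B - A) * (prod f (A \<inter> B) * prod f (A \<inter> B))"
    by (simp add: I)
  finally show ?thesis
    by (simp add: A B ac_simps)
qed

lemma blade_sign_sym_diff_right:
  "blade_sign A (sym_diff B C) = blade_sign A B * blade_sign A C"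
  unfolding blade_sign_def by (subst prod_sym_diff) (auto simp: prod.distrib)

lemma blade_sign_sym_diff_left:
  "blade_sign (sym_diff A B) C = blade_sign A C * blade_sign B C"
  unfolding blade_sign_def
  by (rule prod_sym_diff) (auto simp: prod.distrib [symmetric] intro!: prod.neutral)

lemma sym_diff_cancel: "sym_diff A (sym_diff A B) = B"
  by blast

instantiation clifford :: (finite) ring_1
begin

definition "1 = Clifford (axis {} 1)"

definition "x * y = Clifford
  (\<chi> C. \<Sum>(A, B) \<in> {(A, B). sym_diff A B = C}. blade_sign A B * blade_coeff x A * blade_coeff y B)"

lemma blade_coeff_mult:
  "blade_coeff (x * y) C = (\<Sum>A\<in>UNIV. blade_sign A (sym_diff A C) * blade_coeff x A * blade_coeff y (sym_diff A C))"
  for x y :: "'a clifford"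
proof -
  have "blade_coeff (x * y) C =
      (\<Sum>(A, B) \<in> {(A, B). sym_diff A B = C}. blade_sign A B * blade_coeff x A * blade_coeff y B)"
    by (simp add: times_clifford_def)
  also have "\<dots> = (\<Sum>A\<in>UNIV. blade_sign A (sym_diff A C) * blade_coeff x A * blade_coeff y (sym_diff A C))"
    by (rule sum.reindex_bij_witness [of _ "\<lambda>A. (A, sym_diff A C)" fst])
       (simp_all add: case_prod_beta prod_eq_iff sym_diff_cancel split: prod.splits, (metis sym_diff_cancel)+)
  finally show ?thesis .
qed

lemma blade_coeff_one: "blade_coeff (1 :: 'a clifford) A = (if A = {} then 1 else 0)"
  by (simp add: one_clifford_def axis_def)

instance
proof
  fix x y z :: "'a clifford"
  show "x * y * z = x * (y * z)"
    unfolding clifford_eq_iff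
  proof
    fix D :: "'a set"
    have "blade_coeff (x * y * z) D =
        (\<Sum>E\<in>UNIV. \<Sum>A\<in>UNIV. blade_sign E (sym_diff E D) * blade_sign A (sym_diff A E)
          * blade_coeff x A * blade_coeff y (sym_diff A E) * blade_coeff z (sym_diff E D))"
      by (simp add: blade_coeff_mult sum_distrib_left sum_distrib_right mult.assoc)
    also have "\<dots> = (\<Sum>A\<in>UNIV. \<Sum>E\<in>UNIV. blade_sign E (sym_diff E D) * blade_sign A (sym_diff A E)
          * blade_coeff x A * blade_coeff y (sym_diff A E) * blade_coeff z (sym_diff E D))"
      by (rule sum.swap)
    also have "\<dots> = (\<Sum>A\<in>UNIV. \<Sum>B\<in>UNIV. blade_sign A (sym_diff A D)
        * blade_sign B (sym_diff B (sym_diff A D))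
        * blade_coeff x A * blade_coeff y B * blade_coeff z (sym_diff B (sym_diff A D)))"
    proof (rule sum.cong [OF refl])
      fix A :: "'a set"
      have eq: "sym_diff B (sym_diff A D) = sym_diff (sym_diff A B) D"
        "sym_diff A (sym_diff A B) = B" for B
        by blast+
      have sg: "blade_sign (sym_diff A B) (sym_diff (sym_diff A B) D) * blade_sign A B =
          blade_sign A (sym_diff A D) * blade_sign B (sym_diff (sym_diff A B) D)" for B
      proof -
        have "blade_sign A B * blade_sign A B = 1"
          by (simp add: blade_sign_sym_diff_right [symmetric]) (simp add: blade_sign_def)
        then show ?thesis
          by (simp only: blade_sign_sym_diff_left blade_sign_sym_diff_right) algebra
      qed
      show "(\<Sum>E\<in>UNIV. blade_sign E (sym_diff E D) * blade_sign A (sym_diff A E)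
          * blade_coeff x A * blade_coeff y (sym_diff A E) * blade_coeff z (sym_diff E D)) =
        (\<Sum>B\<in>UNIV. blade_sign A (sym_diff A D) * blade_sign B (sym_diff B (sym_diff A D))
          * blade_coeff x A * blade_coeff y B * blade_coeff z (sym_diff B (sym_diff A D)))"
      proof (rule sum.reindex_bij_witness [of _ "sym_diff A" "sym_diff A"])
        fix E :: "'a set"
        show "blade_sign A (sym_diff A D)
            * blade_sign (sym_diff A E) (sym_diff (sym_diff A E) (sym_diff A D))
            * blade_coeff x A * blade_coeff y (sym_diff A E)
            * blade_coeff z (sym_diff (sym_diff A E) (sym_diff A D)) =
          blade_sign E (sym_diff E D) * blade_sign A (sym_diff A E)
            * blade_coeff x A * blade_coeff y (sym_diff A E) * blade_coeff z (sym_diff E D)"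
          using sg [of "sym_diff A E"] by (simp only: eq)
      qed (simp_all only: eq UNIV_I)
    qed
    also have "\<dots> = blade_coeff (x * (y * z)) D"
      by (simp add: blade_coeff_mult sum_distrib_left sum_distrib_right ac_simps)
    finally show "blade_coeff (x * y * z) D = blade_coeff (x * (y * z)) D" .
  qed
  show "1 * x = x"
    unfolding clifford_eq_iff
  proof
    fix C :: "'a set"
    have "blade_coeff (1 * x) C = (\<Sum>A\<in>(UNIV :: 'a set set). if A = {} then blade_coeff x C else 0)"
      unfolding blade_coeff_mult by (rule sum.cong) (auto simp: blade_coeff_one blade_sign_def)
    then show "blade_coeff (1 * x) C = blade_coeff x C"
      by simp
  qed
  show "x * 1 = x"
    unfolding clifford_eq_iff
  proof
    fix C :: "'a set"
    have "blade_coeff (x * 1) C = (\<Sum>A\<in>UNIV. if A = C then blade_coeff x C else 0)"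
      unfolding blade_coeff_mult by (rule sum.cong) (auto simp: blade_coeff_one blade_sign_def)
    then show "blade_coeff (x * 1) C = blade_coeff x C"
      by simp
  qed
  show "(x + y) * z = x * z + y * z" "x * (y + z) = x * y + x * z"
    by (auto simp: clifford_eq_iff blade_coeff_mult algebra_simps sum.distrib)
  show "(0 :: 'a clifford) \<noteq> 1"
    unfolding clifford_eq_iff by (auto simp: blade_coeff_one intro!: exI [of _ "{}"])
qed

end

instance clifford :: (finite) real_algebra_1
  by standard (auto simp: clifford_eq_iff blade_coeff_mult scaleR_sum_right intro!: sum.cong)

definition blade :: "'n::finite set \<Rightarrow> 'n clifford"
  where "blade A = Clifford (axis A 1)"

definition gen :: "'n::finite \<Rightarrow> 'n clifford"
  where "gen i = blade {i}"

text \<open>The embedding of the scalars \<open>\<complex>\<close> into the Clifford algebra.\<close>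

definition scalar :: "complex \<Rightarrow> 'n::finite clifford"
  where "scalar c = Clifford (axis {} c)"

lemma blade_coeff_scalar_mult: "blade_coeff (scalar c * x) C = c * blade_coeff x C"
  for x :: "'n::finite clifford"
proof -
  have "blade_coeff (scalar c * x) C = (\<Sum>A\<in>(UNIV :: 'n set set). if A = {} then c * blade_coeff x C else 0)"
    unfolding blade_coeff_mult
    by (rule sum.cong) (auto simp: scalar_def axis_def blade_sign_def)
  then show ?thesis
    by simp
qed

lemma blade_mult: "blade A * blade B = scalar (blade_sign A B) * blade (sym_diff A B)"
  unfolding clifford_eq_iff
proof
  fix C
  have "blade_coeff (blade A * blade B) C =
      (\<Sum>E\<in>UNIV. if E = A then if sym_diff A C = B then blade_sign A B else 0 else 0)"
    unfolding blade_coeff_mult by (rule sum.cong) (auto simp: blade_def axis_def)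
  also have "\<dots> = (if sym_diff A C = B then blade_sign A B else 0)"
    by simp
  also have "sym_diff A C = B \<longleftrightarrow> C = sym_diff A B"
    by blast
  finally show "blade_coeff (blade A * blade B) C =
      blade_coeff (scalar (blade_sign A B) * blade (sym_diff A B)) C"
    unfolding blade_coeff_scalar_mult by (simp add: blade_def axis_def)
qed

lemma scalar_eq_iff_simps [simp]: "scalar 1 = 1" "scalar 0 = 0" "scalar (- c) = - scalar c"
  by (auto simp: scalar_def one_clifford_def clifford_eq_iff axis_def)

text \<open>
  The following three facts characterise the algebra: it is generated by elements satisfying the
  Clifford relations, and the ordered products \<open>e\<^sub>A\<close> of generators form a basis.
\<close>

lemma gen_mult: "gen i * gen j + gen j * gen i = (if i = j then - 2 else 0)"
proof (cases "i = j")
  case True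
  then show ?thesis
    by (simp add: gen_def blade_mult blade_sign_def) (simp add: blade_def one_clifford_def [symmetric])
next
  case False
  have "sym_diff {i} {j} = {i, j}" "sym_diff {j} {i} = {i, j}"
    using False by auto
  moreover have "to_nat i \<noteq> to_nat j"
    using False by simp
  ultimately show ?thesis
    using False by (auto simp: gen_def blade_mult blade_sign_def)
qed

lemma blade_insert:
  assumes "\<And>j. j \<in> A \<Longrightarrow> to_nat i < to_nat j"
  shows "blade (insert i A) = gen i * blade A"
proof -
  have "i \<notin> A"
    using assms by blast
  then have "sym_diff {i} A = insert i A"
    by auto
  moreover have "blade_sign {i} A = 1"
    using assms by (force simp: blade_sign_def intro!: prod.neutral)
  ultimately show ?thesis
    by (simp add: gen_def blade_mult)
qed

lemma clifford_expand: "x = (\<Sum>A\<in>UNIV. scalar (blade_coeff x A) * blade A)"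
proof -
  have c: "coeffs (sum f S) = (\<Sum>A\<in>S. coeffs (f A))" for f :: "'a set \<Rightarrow> 'a clifford" and S
    by (induction S rule: infinite_finite_induct) auto
  show ?thesis
    unfolding clifford_eq_iff c
    by (simp add: blade_coeff_scalar_mult blade_def axis_def if_distrib cong: if_cong)
qed


section \<open>Vectors and the Dirac operator on \<open>\<real>\<^sup>p \<times> \<real>\<^sup>q\<close>\<close>

text \<open>
  The dimensions are \<open>p = CARD('p)\<close> and \<open>q = CARD('q)\<close>, both automatically positive.  The generators
  \<open>e\<^sub>1, \<dots>, e\<^sub>p\<close> are \<open>gen (Inl j)\<close>, and \<open>e\<^sub>p\<^sub>+\<^sub>1, \<dots>, e\<^sub>p\<^sub>+\<^sub>q\<close> are \<open>gen (Inr j)\<close>.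
\<close>

definition xvec :: "real ^ 'p \<Rightarrow> ('p::finite + 'q::finite) clifford"
  where "xvec x = (\<Sum>j\<in>UNIV. (x $ j) *\<^sub>R gen (Inl j))"

definition yvec :: "real ^ 'q \<Rightarrow> ('p::finite + 'q::finite) clifford"
  where "yvec y = (\<Sum>j\<in>UNIV. (y $ j) *\<^sub>R gen (Inr j))"

definition dirac_x ::
    "((real ^ 'p) \<times> (real ^ 'q) \<Rightarrow> ('p::finite + 'q::finite) clifford) \<Rightarrow>
      (real ^ 'p) \<times> (real ^ 'q) \<Rightarrow> ('p + 'q) clifford"
  where "dirac_x F z = (\<Sum>j\<in>UNIV. gen (Inl j) *
    vector_derivative (\<lambda>t. F (fst z + t *\<^sub>R axis j 1, snd z)) (at 0))"

definition dirac_y ::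
    "((real ^ 'p) \<times> (real ^ 'q) \<Rightarrow> ('p::finite + 'q::finite) clifford) \<Rightarrow>
      (real ^ 'p) \<times> (real ^ 'q) \<Rightarrow> ('p + 'q) clifford"
  where "dirac_y F z = (\<Sum>j\<in>UNIV. gen (Inr j) *
    vector_derivative (\<lambda>t. F (fst z, snd z + t *\<^sub>R axis j 1)) (at 0))"

text \<open>
  Differentiability is part of being annihilated by the operator, since \<open>vector_derivative\<close> is
  an unspecified value where the derivative does not exist.
\<close>

definition monogenic ::
    "((real ^ 'p) \<times> (real ^ 'q) \<Rightarrow> ('p::finite + 'q::finite) clifford) \<Rightarrow> bool"
  where "monogenic F \<longleftrightarrow> (\<forall>z. F differentiable (at z) \<and> dirac_x F z + dirac_y F z = 0)"

definition hypermonogenic_plane_wave ::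
    "real ^ 'q \<Rightarrow> ((real ^ 'p) \<times> (real ^ 'q) \<Rightarrow> ('p::finite + 'q::finite) clifford) \<Rightarrow> bool"
  where "hypermonogenic_plane_wave s F \<longleftrightarrow>
    (\<exists>C D :: nat \<Rightarrow> real \<Rightarrow> complex.
      (\<forall>j t. C j differentiable (at t) \<and> D j differentiable (at t)) \<and>
      (\<forall>x y. (\<lambda>j. xvec x ^ j * (scalar (C j (y \<bullet> s)) + yvec s * scalar (D j (y \<bullet> s))))
        sums F (x, y))) \<and>
    monogenic F"

definition exp_plane_wave_series ::
    "(nat \<Rightarrow> complex) \<Rightarrow> (nat \<Rightarrow> complex) \<Rightarrow> real ^ 'q \<Rightarrow>
      ((real ^ 'p) \<times> (real ^ 'q) \<Rightarrow> ('p::finite + 'q::finite) clifford) \<Rightarrow> bool"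
  where "exp_plane_wave_series c d s F \<longleftrightarrow>
    (\<forall>x y. (\<lambda>j. xvec x ^ j * (scalar (c j) + yvec s * scalar (d j))
        * scalar (of_real (exp (y \<bullet> s)))) sums F (x, y))"


section \<open>The Bessel function and the closed form\<close>

text \<open>
  The case distinction is needed because \<open>0 powr 0 = 0\<close> in HOL.
\<close>

definition Bessel_J :: "complex \<Rightarrow> complex \<Rightarrow> complex"
  where "Bessel_J \<nu> z = (if \<nu> = 0 then 1 else z powr \<nu> / 2 powr \<nu>) *
    (\<Sum>j. (-1) ^ j * z ^ (2 * j) / (fact j * 2 ^ (2 * j) * Gamma (\<nu> + of_nat j + 1)))"

text \<open>The expression is meaningful for \<open>x \<noteq> 0\<close> only.\<close>

definition bessel_wave_formula ::
    "real ^ 'q \<Rightarrow> (real ^ 'p) \<times> (real ^ 'q) \<Rightarrow> ('p::finite + 'q::finite) clifford"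
  where "bessel_wave_formula s = (\<lambda>(x, y).
    let \<mu> = real CARD('p) / 2; r = norm x in
      (2 powr (\<mu> - 1) * Gamma \<mu> / r powr (\<mu> - 1)) *\<^sub>R
      (scalar (Bessel_J (of_real (\<mu> - 1)) (of_real r)) +
       scalar (Bessel_J (of_real \<mu>) (of_real r)) * (xvec x /\<^sub>R r) * yvec s) *
      scalar (of_real (exp (y \<bullet> s))))"

definition bessel_wave ::
    "real ^ 'q \<Rightarrow> (real ^ 'p) \<times> (real ^ 'q) \<Rightarrow> ('p::finite + 'q::finite) clifford"
  where "bessel_wave s z =
    (if fst z = 0 then Lim (at z within {w. fst w \<noteq> 0}) (bessel_wave_formula s)
     else bessel_wave_formula s z)"

end

theory Submission
  imports Defs "HOL-Complex_Analysis.Cauchy_Integral_Formula"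
begin

text \<open>
  Write \<open>X = xvec x\<close>, \<open>S = yvec s\<close>, \<open>u = x \<bullet> x\<close> and let \<open>p\<close> be the dimension of the space of \<open>x\<close>.  Since
  \<open>X * X = - u\<close> is a scalar, splitting a plane wave series into terms of even and odd index turns it
  into \<open>(f u + X g u + (h u + X k u) S) exp (y \<bullet> s)\<close> with four complex power series \<open>f\<close>, \<open>g\<close>, \<open>h\<close>, \<open>k\<close>.
  Convergence at all points of the Clifford-valued series makes these entire
  (\<open>entire_series_of_exp_plane_wave\<close>), so they may be differentiated freely and no termwise
  differentiation of the Clifford-valued series is needed.

  The Dirac operator maps such a wave to another one (\<open>dirac_radial_wave\<close>), and \<open>1\<close>, \<open>X\<close>, \<open>S\<close>, \<open>X S\<close>
  are linearly independent for \<open>x \<noteq> 0\<close> (\<open>radial_wave_eq_0_iff\<close>).  Monogenicity therefore amounts to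
  the equations \<open>2 f' = - k\<close>, \<open>p k + 2 u k' = f\<close> and \<open>2 h' = g\<close>, \<open>p g + 2 u g' = - h\<close>.  On
  coefficients these are first-order recurrences (\<open>monogenic_radial_powser_iff\<close>), and the initial
  values \<open>f 0 = 1\<close>, \<open>h 0 = 0\<close> determine all four series: \<open>g\<close> and \<open>h\<close> vanish, and the coefficients of
  \<open>f\<close> and \<open>k\<close> are those of the Bessel functions of order \<open>p / 2 - 1\<close> and \<open>p / 2\<close> after removal of the
  fractional powers (\<open>recurrence_unique\<close>, \<open>bessel_wave_formula_eq\<close>).

  The equivalence runs in both directions, so it gives existence and uniqueness together.  The
  power series form is continuous at \<open>x = 0\<close>, which identifies the continuous extension there
  (\<open>bessel_wave_eq\<close>).
\<close>

section \<open>Calculus in the Clifford algebra\<close>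

lemma linear_Clifford: "linear (Clifford :: complex ^ 'n::finite set \<Rightarrow> _)"
  by standard (auto simp: clifford_eq_iff)

lemma bounded_linear_coeffs: "bounded_linear (coeffs :: 'n::finite clifford \<Rightarrow> _)"
  by (rule bounded_linear_intro[where K=1]) (auto simp: norm_clifford_def)

lemma bounded_linear_blade_coeff: "bounded_linear (\<lambda>v :: 'n::finite clifford. blade_coeff v A)"
  by (rule bounded_linear_compose[OF bounded_linear_vec_nth bounded_linear_coeffs])

text \<open>The Euclidean norm of the coefficients is not submultiplicative, so the algebra is not a normed
  algebra for it.  Boundedness of the product is therefore transported along the isometry
  \<^const>\<open>coeffs\<close> from the Euclidean space of coefficient vectors, where every bilinear map is
  bounded.\<close>

lemma bounded_bilinear_clifford_mult:
  "bounded_bilinear ((*) :: 'n::finite clifford \<Rightarrow> 'n clifford \<Rightarrow> 'n clifford)"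
proof -
  let ?h = "\<lambda>v w. coeffs (Clifford v * Clifford w :: 'n clifford)"
  have "bilinear ?h"
    unfolding bilinear_def
    by (intro conjI allI; rule linearI)
       (simp_all add: linear_add[OF linear_Clifford] linear_scale[OF linear_Clifford] algebra_simps)
  then have "bounded_bilinear ?h"
    by (simp add: bilinear_conv_bounded_bilinear)
  then obtain K where K: "\<And>v w. norm (?h v w) \<le> norm v * norm w * K"
    by (meson bounded_bilinear.bounded)
  show ?thesis
  proof
    show "\<exists>K. \<forall>a b :: 'n clifford. norm (a * b) \<le> norm a * norm b * K"
      using K[of "coeffs _" "coeffs _"] by (auto simp: norm_clifford_def coeffs_inverse)
  qed (auto simp: algebra_simps)
qed

interpretation clifford_mult:
  bounded_bilinear "(*) :: 'n::finite clifford \<Rightarrow> 'n clifford \<Rightarrow> 'n clifford"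
  by (rule bounded_bilinear_clifford_mult)

subsection \<open>Scalars\<close>

lemma blade_coeff_scalar: "blade_coeff (scalar c) A = (if A = {} then c else 0)"
  by (simp add: scalar_def axis_def)

lemma scalar_commute: "x * scalar c = scalar c * x" for x :: "'n::finite clifford"
  unfolding clifford_eq_iff
proof
  fix C :: "'n set"
  have "blade_coeff (x * scalar c) C =
      (\<Sum>A\<in>UNIV. if A = C then c * blade_coeff x C else 0)"
    unfolding blade_coeff_mult
    by (rule sum.cong) (auto simp: blade_coeff_scalar blade_sign_def)
  then show "blade_coeff (x * scalar c) C = blade_coeff (scalar c * x) C"
    by (simp add: blade_coeff_scalar_mult)
qed

lemma scalar_left_commute: "x * (scalar c * y) = scalar c * (x * y)"
  by (metis mult.assoc scalar_commute)

lemma scalar_add: "scalar (a + b) = scalar a + scalar b"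
  and scalar_diff: "scalar (a - b) = scalar a - scalar b"
  and scalar_scaleR: "scalar (r *\<^sub>R a) = r *\<^sub>R scalar a"
  by (auto simp: clifford_eq_iff blade_coeff_scalar)

lemma scalar_mult: "scalar (a * b) = scalar a * scalar b"
  by (auto simp: clifford_eq_iff blade_coeff_scalar blade_coeff_scalar_mult)

lemma scalar_power: "scalar (a ^ n) = scalar a ^ n"
  by (induction n) (auto simp: scalar_mult)

lemma scalar_of_real: "scalar (of_real r) = of_real r"
  by (metis scaleR_conv_of_real mult.right_neutral of_real_def scalar_scaleR scalar_eq_iff_simps(1))

lemma scalar_eq_iff: "scalar a = scalar b \<longleftrightarrow> a = b"
  by (metis blade_coeff_scalar)

lemma bounded_linear_scalar: "bounded_linear (scalar :: complex \<Rightarrow> 'n::finite clifford)"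
  by (intro linear_conv_bounded_linear[THEN iffD1] linearI) (auto simp: scalar_add scalar_scaleR)

subsection \<open>Vectors\<close>

lemma xvec_add: "xvec (a + b) = xvec a + xvec b"
  and xvec_scaleR: "xvec (r *\<^sub>R a) = r *\<^sub>R xvec a"
  by (simp_all add: xvec_def scaleR_left.add sum.distrib scaleR_right.sum algebra_simps scaleR_sum_right)

lemma bounded_linear_xvec: "bounded_linear xvec"
  by (intro linear_conv_bounded_linear[THEN iffD1] linearI) (auto simp: xvec_add xvec_scaleR)

text \<open>Symmetrising the double sum for the square leaves only the diagonal terms of the Clifford
  relations.  The injection \<open>g\<close> selects either group of generators.\<close>

lemma sum_gen_square:
  fixes g :: "'m::finite \<Rightarrow> 'n::finite" and v :: "real ^ 'm"
  assumes "inj g"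
  shows "(\<Sum>j\<in>UNIV. (v $ j) *\<^sub>R gen (g j)) * (\<Sum>j\<in>UNIV. (v $ j) *\<^sub>R gen (g j)) = of_real (- (v \<bullet> v))"
    (is "?V * ?V = _")
proof -
  let ?T = "\<lambda>i j. (v $ i * v $ j) *\<^sub>R (gen (g i) * gen (g j))"
  have 1: "?V * ?V = (\<Sum>i\<in>UNIV. \<Sum>j\<in>UNIV. ?T i j)"
    by (simp add: sum_product mult.commute)
  have 2: "?V * ?V = (\<Sum>i\<in>UNIV. \<Sum>j\<in>UNIV. ?T j i)"
    unfolding 1 by (rule sum.swap)
  have "2 *\<^sub>R (?V * ?V) = (\<Sum>i\<in>UNIV. \<Sum>j\<in>UNIV. ?T i j + ?T j i)"
    unfolding scaleR_2 by (subst 1, subst 2) (simp add: sum.distrib)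
  also have "\<dots> = (\<Sum>i\<in>UNIV. \<Sum>j\<in>UNIV. (v $ i * v $ j) *\<^sub>R (if i = j then -2 else 0))"
  proof (intro sum.cong refl)
    fix i j
    have "?T i j + ?T j i = (v $ i * v $ j) *\<^sub>R (gen (g i) * gen (g j) + gen (g j) * gen (g i))"
      by (simp add: scaleR_add_right mult.commute)
    then show "?T i j + ?T j i = (v $ i * v $ j) *\<^sub>R (if i = j then -2 else 0)"
      unfolding gen_mult using assms by (simp add: inj_eq)
  qed
  also have "\<dots> = (\<Sum>i\<in>UNIV. \<Sum>j\<in>UNIV. if i = j then 2 *\<^sub>R of_real (- (v $ i * v $ j)) else 0)"
    by (intro sum.cong refl) (auto simp: scaleR_conv_of_real mult_2 mult_2_right)
  also have "\<dots> = 2 *\<^sub>R of_real (- (v \<bullet> v))"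
    by (simp add: inner_vec_def sum_negf scaleR_sum_right)
  finally show ?thesis
    by (simp only: scaleR_cancel_left) simp
qed

lemma xvec_square: "xvec x * xvec x = of_real (- (x \<bullet> x))"
  unfolding xvec_def by (rule sum_gen_square) simp

lemma yvec_square: "yvec y * yvec y = of_real (- (y \<bullet> y))"
  unfolding yvec_def by (rule sum_gen_square) simp

lemma gen_Inr_xvec:
  fixes i :: "'b::finite" and x :: "real ^ 'a::finite"
  shows "gen (Inr i) * xvec x = - (xvec x * gen (Inr i))"
proof -
  have "gen (Inr i) * gen (Inl j) = - (gen (Inl j) * gen (Inr i) :: ('a + 'b) clifford)" for j :: 'a
    using gen_mult[of "Inr i" "Inl j"] by (simp add: eq_neg_iff_add_eq_0)
  then show ?thesis
    by (simp add: xvec_def sum_distrib_left sum_distrib_right sum_negf[symmetric])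
qed

lemma yvec_xvec: "yvec s * xvec x = - (xvec x * yvec s)"
proof -
  have "yvec s * xvec x = (\<Sum>j\<in>UNIV. (s $ j) *\<^sub>R (gen (Inr j) * xvec x))"
    by (simp add: yvec_def sum_distrib_right)
  also have "\<dots> = - (xvec x * yvec s)"
    unfolding gen_Inr_xvec by (simp add: yvec_def sum_distrib_left sum_negf)
  finally show ?thesis .
qed

lemma gen_square: "gen i * gen i = - 1"
proof -
  have "2 *\<^sub>R (gen i * gen i) = 2 *\<^sub>R (- 1)"
    using gen_mult[of i i] unfolding scaleR_2 by simp
  then show ?thesis
    by (simp only: scaleR_cancel_left) simp
qed

section \<open>Radial waves and the Dirac operator\<close>

text \<open>
  For \<open>x \<noteq> 0\<close> and \<open>norm s = 1\<close> the anticommuting vectors \<open>xvec x\<close> and \<open>yvec s\<close> have nonzero scalar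
  squares and generate a four-dimensional complex algebra, with basis \<open>1\<close>, \<open>xvec x\<close>, \<open>yvec s\<close> and
  \<open>xvec x * yvec s\<close>.  The exponential plane waves have values in this algebra, and up to the
  exponential their coordinates depend on \<open>u = x \<bullet> x\<close> only.  Taking \<open>u\<close> instead of \<open>norm x\<close> as the variable avoids the singularity
  of the norm at the origin.
\<close>

definition radial_wave ::
    "real ^ 'q \<Rightarrow> (real \<Rightarrow> complex) \<Rightarrow> (real \<Rightarrow> complex) \<Rightarrow> (real \<Rightarrow> complex) \<Rightarrow> (real \<Rightarrow> complex) \<Rightarrow>
      (real ^ 'p) \<times> (real ^ 'q) \<Rightarrow> ('p::finite + 'q::finite) clifford"
  where "radial_wave s f g h k = (\<lambda>(x, y).
    (scalar (f (x \<bullet> x)) + xvec x * scalar (g (x \<bullet> x)) +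
      (scalar (h (x \<bullet> x)) + xvec x * scalar (k (x \<bullet> x))) * yvec s) * scalar (of_real (exp (y \<bullet> s))))"

lemma yvec_flip:
  "yvec s * (scalar a + xvec x * scalar b) = (scalar a - xvec x * scalar b) * yvec s"
proof -
  have "yvec s * (xvec x * scalar b) = - (xvec x * scalar b * yvec s)"
    by (simp add: mult.assoc[symmetric] yvec_xvec) (simp add: mult.assoc scalar_commute)
  then show ?thesis
    by (simp add: distrib_left left_diff_distrib scalar_commute)
qed

text \<open>This is the linear independence of \<open>1\<close>, \<open>X\<close>, \<open>S\<close>, \<open>X S\<close> over the complex numbers.  It comes from two
  conjugations: sandwiching between two factors \<open>X\<close> separates the terms with and without \<open>S\<close>, because
  \<open>X\<close> and \<open>S\<close> anticommute, and sandwiching between two factors \<open>S\<close> then separates \<open>1\<close> from \<open>X\<close>.  At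
  \<open>x = 0\<close> the vector \<open>X\<close> vanishes and the independence fails.\<close>

lemma radial_wave_eq_0_iff:
  fixes s :: "real ^ 'q" and x :: "real ^ 'p"
  assumes s: "norm s = 1" and x: "x \<noteq> 0"
  shows "radial_wave s f g h k (x, y) = 0 \<longleftrightarrow>
    f (x \<bullet> x) = 0 \<and> g (x \<bullet> x) = 0 \<and> h (x \<bullet> x) = 0 \<and> k (x \<bullet> x) = 0"
proof
  define X :: "('p + 'q) clifford" where "X = xvec x"
  define S :: "('p + 'q) clifford" where "S = yvec s"
  define u where "u = x \<bullet> x"
  have XX: "X * X = of_real (- u)" and SS: "S * S = -1" and SX: "S * X = - (X * S)" and u: "u \<noteq> 0"
    using s x by (simp_all add: X_def S_def u_def xvec_square yvec_square yvec_xvec norm_eq_1)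
  have half: "a = 0 \<and> b = 0" if ab: "scalar a + X * scalar b = 0" for a b
  proof -
    have "scalar a - X * scalar b = - (S * (scalar a + X * scalar b) * S)"
      unfolding X_def S_def yvec_flip by (simp add: mult.assoc SS[unfolded S_def])
    then have "scalar a - X * scalar b = 0"
      by (simp add: ab)
    with ab have "2 *\<^sub>R scalar a = (0 :: ('p + 'q) clifford)"
      by (simp add: scaleR_2)
    then have a: "scalar a = (0 :: ('p + 'q) clifford)"
      by simp
    with ab have "X * (X * scalar b) = 0"
      by simp
    then have "(- u) *\<^sub>R scalar b = (0 :: ('p + 'q) clifford)"
      by (simp add: mult.assoc[symmetric] XX scaleR_conv_of_real)
    with a u show ?thesis
      by (metis neg_equal_0_iff_equal scalar_eq_iff scalar_eq_iff_simps(2) scaleR_eq_0_iff)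
  qed
  assume *: "radial_wave s f g h k (x, y) = 0"
  define P where "P = scalar (f u) + X * scalar (g u)"
  define Q where "Q = scalar (h u) + X * scalar (k u)"
  have "(P + Q * S) * scalar (of_real (exp (y \<bullet> s))) = 0"
    using * by (simp add: radial_wave_def P_def Q_def X_def S_def u_def)
  then have PQ: "P + Q * S = 0"
    by (simp add: scalar_of_real) (simp add: of_real_def)
  have "X * P = P * X" "X * Q = Q * X"
    by (simp_all add: P_def Q_def algebra_simps scalar_commute scalar_left_commute)
  then have "X * (P + Q * S) * X = P * (X * X) - Q * ((X * X) * S)"
    by (simp add: distrib_left distrib_right mult.assoc[symmetric]) (simp add: mult.assoc SX)
  also have "\<dots> = (- u) *\<^sub>R (P - Q * S)"
    unfolding XX by (simp add: of_real_def scaleR_right_diff_distrib)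
  finally have "(- u) *\<^sub>R (P - Q * S) = 0"
    by (simp add: PQ)
  with u have "P - Q * S = 0"
    by simp
  with PQ have "2 *\<^sub>R P = 0"
    by (simp add: scaleR_2)
  then have P: "P = 0"
    by simp
  with PQ have "Q * S * S = 0"
    by simp
  then have Q: "Q = 0"
    by (simp add: mult.assoc SS)
  show "f (x \<bullet> x) = 0 \<and> g (x \<bullet> x) = 0 \<and> h (x \<bullet> x) = 0 \<and> k (x \<bullet> x) = 0"
    using half P Q unfolding P_def Q_def u_def by blast
qed (simp add: radial_wave_def)

lemma has_derivative_radial_wave:
  fixes s :: "real ^ 'q" and x :: "real ^ 'p"
  defines "u \<equiv> x \<bullet> x"
  assumes "(f has_vector_derivative f') (at u)" "(g has_vector_derivative g') (at u)"
    "(h has_vector_derivative h') (at u)" "(k has_vector_derivative k') (at u)"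
  shows "(radial_wave s f g h k has_derivative
      (\<lambda>(v, w). ((2 * (x \<bullet> v)) *\<^sub>R (scalar f' + xvec x * scalar g' + (scalar h' + xvec x * scalar k') * yvec s)
          + xvec v * (scalar (g u) + scalar (k u) * yvec s)) * scalar (of_real (exp (y \<bullet> s)))
        + (w \<bullet> s) *\<^sub>R radial_wave s f g h k (x, y))) (at (x, y))"
proof -
  have u: "((\<lambda>z. fst z \<bullet> fst z) has_derivative (\<lambda>v. 2 * (x \<bullet> fst v))) (at (x, y))"
    by (auto intro!: derivative_eq_intros simp: inner_commute)
  have radial: "((\<lambda>z. scalar (\<phi> (fst z \<bullet> fst z))) has_derivative (\<lambda>v. (2 * (x \<bullet> fst v)) *\<^sub>R scalar \<phi>')) (at (x, y))"
    if "(\<phi> has_vector_derivative \<phi>') (at u)" for \<phi> \<phi>'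
  proof -
    have "((\<lambda>z. \<phi> (fst z \<bullet> fst z)) has_derivative (\<lambda>v. (2 * (x \<bullet> fst v)) *\<^sub>R \<phi>')) (at (x, y))"
      using has_derivative_compose[OF u, of \<phi>] that
      by (simp add: has_vector_derivative_def u_def)
    from bounded_linear.has_derivative[OF bounded_linear_scalar this] show ?thesis
      by (simp add: scalar_scaleR)
  qed
  have X: "((\<lambda>z. xvec (fst z)) has_derivative (\<lambda>v. xvec (fst v))) (at (x, y))"
    by (rule bounded_linear.has_derivative[OF bounded_linear_xvec]) (auto intro: derivative_intros)
  have E: "((\<lambda>z. scalar (of_real (exp (snd z \<bullet> s)))) has_derivative
      (\<lambda>v. (snd v \<bullet> s) *\<^sub>R scalar (of_real (exp (y \<bullet> s))))) (at (x, y))"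
  proof -
    have "((\<lambda>z. of_real (exp (snd z \<bullet> s)) :: complex) has_derivative
      (\<lambda>v. (snd v \<bullet> s) *\<^sub>R of_real (exp (y \<bullet> s)))) (at (x, y))"
      by (auto intro!: derivative_eq_intros simp: scaleR_conv_of_real)
    from bounded_linear.has_derivative[OF bounded_linear_scalar this] show ?thesis
      by (simp only: scalar_scaleR)
  qed
  show ?thesis
    unfolding radial_wave_def case_prod_unfold
    by (rule has_derivative_eq_rhs,
        (rule has_derivative_add clifford_mult.FDERIV has_derivative_const radial X E assms)+)
       (simp add: fun_eq_iff u_def algebra_simps)
qed

text \<open>The partial derivatives in the Dirac operators are derivatives along lines; the full derivative
  gives all of them at once.\<close>

lemma vector_derivative_line:
  assumes "(F has_derivative D) (at z)"
  shows "vector_derivative (\<lambda>t. F (z + t *\<^sub>R v)) (at 0) = D v"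
proof (rule vector_derivative_at)
  have "((\<lambda>t. z + t *\<^sub>R v) has_derivative (\<lambda>t. t *\<^sub>R v)) (at 0)"
    by (auto intro!: derivative_eq_intros)
  from has_derivative_compose[OF this, of F D] assms
  show "((\<lambda>t. F (z + t *\<^sub>R v)) has_vector_derivative D v) (at 0)"
    by (simp add: has_vector_derivative_def linear_scale[OF has_derivative_linear[OF assms]])
qed

text \<open>With \<open>u = x \<bullet> x\<close> the Dirac operator in \<open>x\<close> sends \<open>f u\<close> to \<open>2 X f' u\<close> and \<open>X g u\<close> to
  \<open>- (p g u + 2 u g' u)\<close>: the first term comes from the squares of the \<open>p\<close> generators, the second
  from \<open>X * X = - u\<close>.  The Dirac operator in \<open>y\<close> only meets the exponential and so acts as left
  multiplication by \<open>S\<close>, which is moved to the right past \<open>X\<close> with a change of sign and satisfies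
  \<open>S * S = -1\<close>.  The sum is again a radial wave, so that the equation becomes four scalar ones.\<close>

lemma dirac_radial_wave:
  fixes s :: "real ^ 'q" and z :: "(real ^ 'p) \<times> (real ^ 'q)"
  assumes s: "norm s = 1"
    and deriv: "\<And>u. (f has_vector_derivative f' u) (at u)" "\<And>u. (g has_vector_derivative g' u) (at u)"
      "\<And>u. (h has_vector_derivative h' u) (at u)" "\<And>u. (k has_vector_derivative k' u) (at u)"
  shows "dirac_x (radial_wave s f g h k) z + dirac_y (radial_wave s f g h k) z =
    radial_wave s
      (\<lambda>u. - (of_nat CARD('p) * g u + 2 * of_real u * g' u) - h u)
      (\<lambda>u. 2 * f' u + k u)
      (\<lambda>u. f u - (of_nat CARD('p) * k u + 2 * of_real u * k' u))
      (\<lambda>u. 2 * h' u - g u) z"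
proof (cases z)
  case (Pair x y)
  define X :: "('p + 'q) clifford" where "X = xvec x"
  define S :: "('p + 'q) clifford" where "S = yvec s"
  define E :: "('p + 'q) clifford" where "E = scalar (of_real (exp (y \<bullet> s)))"
  define u where "u = x \<bullet> x"
  define M where "M = scalar (f' u) + X * scalar (g' u) + (scalar (h' u) + X * scalar (k' u)) * S"
  define N where "N = scalar (g u) + scalar (k u) * S"
  define Q where "Q = scalar (f u) + X * scalar (g u) + (scalar (h u) + X * scalar (k u)) * S"
  have XX: "X * X = of_real (- u)" and SS: "S * S = -1"
    using s by (simp_all add: X_def S_def u_def xvec_square yvec_square norm_eq_1)
  have W: "radial_wave s f g h k (x, y) = Q * E"
    by (simp add: radial_wave_def Q_def X_def S_def E_def u_def)
  have D: "(radial_wave s f g h k has_derivative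
      (\<lambda>(v, w). ((2 * (x \<bullet> v)) *\<^sub>R M + xvec v * N) * E + (w \<bullet> s) *\<^sub>R (Q * E))) (at (x, y))"
    using has_derivative_radial_wave[OF deriv[of "x \<bullet> x"], of s y]
    by (simp add: M_def N_def W E_def X_def S_def u_def)
  have axis: "xvec (axis j 1) = (gen (Inl j) :: ('p + 'q) clifford)" for j
  proof -
    have "xvec (axis j 1) = (\<Sum>i\<in>UNIV. if i = j then gen (Inl i) else 0 :: ('p + 'q) clifford)"
      unfolding xvec_def by (intro sum.cong) (auto simp: axis_def)
    then show ?thesis by simp
  qed
  have "dirac_x (radial_wave s f g h k) (x, y) =
      (\<Sum>j\<in>UNIV. gen (Inl j) * (((2 * x $ j) *\<^sub>R M + gen (Inl j) * N) * E))"
    unfolding dirac_x_def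
  proof (intro sum.cong refl arg_cong2[of _ _ _ _ "(*)"])
    fix j :: 'p
    show "vector_derivative (\<lambda>t. radial_wave s f g h k (fst (x, y) + t *\<^sub>R axis j 1, snd (x, y))) (at 0) =
      ((2 * x $ j) *\<^sub>R M + gen (Inl j) * N) * E"
      using vector_derivative_line[OF D, of "(axis j 1, 0)"] by (simp add: axis inner_axis)
  qed
  also have "\<dots> = (\<Sum>j\<in>UNIV. 2 *\<^sub>R ((x $ j *\<^sub>R gen (Inl j)) * M * E) - N * E)"
    by (intro sum.cong refl)
      (simp add: distrib_left distrib_right mult.assoc[symmetric] gen_square)
  also have "\<dots> = 2 *\<^sub>R (X * M * E) - of_nat CARD('p) * (N * E)"
    by (simp add: sum_subtractf scaleR_sum_right sum_distrib_right X_def xvec_def)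
  finally have dx: "dirac_x (radial_wave s f g h k) (x, y) = 2 *\<^sub>R (X * M * E) - of_nat CARD('p) * (N * E)" .
  have "dirac_y (radial_wave s f g h k) (x, y) = (\<Sum>j\<in>UNIV. gen (Inr j) * (s $ j *\<^sub>R (Q * E)))"
    unfolding dirac_y_def
  proof (intro sum.cong refl arg_cong2[of _ _ _ _ "(*)"])
    fix j :: 'q
    show "vector_derivative (\<lambda>t. radial_wave s f g h k (fst (x, y), snd (x, y) + t *\<^sub>R axis j 1)) (at 0) =
      s $ j *\<^sub>R (Q * E)"
      using vector_derivative_line[OF D, of "(0, axis j 1)"] 
      by (simp add: inner_axis' xvec_def)
  qed
  also have "\<dots> = S * Q * E"
    by (simp add: S_def yvec_def sum_distrib_right mult.assoc)
  finally have dy: "dirac_y (radial_wave s f g h k) (x, y) = S * Q * E" .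
  \<comment> \<open>\<open>Q\<close> is the wave without the exponential, \<open>M\<close> its derivative in \<open>u\<close>, and \<open>N\<close> its coefficient of \<open>X\<close>.\<close>
  have "S * Q = S * (scalar (f u) + X * scalar (g u)) + S * (scalar (h u) + X * scalar (k u)) * S"
    by (simp add: Q_def distrib_left distrib_right mult.assoc)
  also have "\<dots> = (scalar (f u) - X * scalar (g u)) * S - (scalar (h u) - X * scalar (k u))"
    unfolding X_def S_def yvec_flip by (simp add: mult.assoc SS[unfolded S_def])
  finally have SQ: "S * Q = (scalar (f u) - X * scalar (g u)) * S - (scalar (h u) - X * scalar (k u))" .
  have XM: "X * M = X * scalar (f' u) - u *\<^sub>R scalar (g' u) + (X * scalar (h' u) - u *\<^sub>R scalar (k' u)) * S"
    unfolding M_def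
    by (simp add: distrib_left distrib_right mult.assoc[symmetric] XX left_diff_distrib)
      (simp add: of_real_def)
  have real_factors: "of_nat CARD('p) * c = real CARD('p) *\<^sub>R c" "of_real u * c = u *\<^sub>R c"
    "2 * c = 2 *\<^sub>R c" for c :: complex
    by (simp_all add: scaleR_conv_of_real)
  have pN: "of_nat CARD('p) * N = real CARD('p) *\<^sub>R N"
    by (simp add: scaleR_conv_of_real)
  have "2 *\<^sub>R (X * M) - of_nat CARD('p) * N + S * Q =
      scalar (- (of_nat CARD('p) * g u + 2 * of_real u * g' u) - h u)
      + X * scalar (2 * f' u + k u)
      + (scalar (f u - (of_nat CARD('p) * k u + 2 * of_real u * k' u))
      + X * scalar (2 * h' u - g u)) * S"
    unfolding SQ XM pN real_factors unfolding N_def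
    by (simp add: real_factors scalar_add scalar_diff scalar_scaleR algebra_simps)
  moreover have "dirac_x (radial_wave s f g h k) (x, y) + dirac_y (radial_wave s f g h k) (x, y) =
      (2 *\<^sub>R (X * M) - of_nat CARD('p) * N + S * Q) * E"
    by (simp add: dx dy algebra_simps)
  ultimately show ?thesis
    by (simp add: Pair radial_wave_def X_def S_def E_def u_def)
qed

section \<open>Everywhere convergent power series\<close>

definition entire_series :: "(nat \<Rightarrow> complex) \<Rightarrow> bool"
  where "entire_series a \<longleftrightarrow> (\<forall>z. summable (\<lambda>n. a n * z ^ n))"

definition powser :: "(nat \<Rightarrow> complex) \<Rightarrow> real \<Rightarrow> complex"
  where "powser a u = (\<Sum>n. a n * of_real u ^ n)"

lemma powser_sums: "entire_series a \<Longrightarrow> (\<lambda>n. a n * of_real u ^ n) sums powser a u"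
  by (simp add: entire_series_def powser_def summable_sums)

lemma powser_unique: "(\<lambda>n. a n * of_real u ^ n) sums v \<Longrightarrow> powser a u = v"
  by (simp add: powser_def sums_iff)

lemma entire_series_diffs: "entire_series a \<Longrightarrow> entire_series (diffs a)"
  by (simp add: entire_series_def termdiff_converges_all)

lemma powser_has_vector_derivative:
  assumes "entire_series a"
  shows "(powser a has_vector_derivative powser (diffs a) u) (at u)"
proof -
  have "((\<lambda>z. \<Sum>n. a n * z ^ n) has_field_derivative powser (diffs a) u) (at (of_real u))"
    unfolding powser_def
    by (rule termdiffs_strong_converges_everywhere) (use assms in \<open>simp add: entire_series_def\<close>)
  then show ?thesis
    unfolding powser_def[abs_def] by (rule has_vector_derivative_real_field)
qed

lemma entire_series_add: "entire_series a \<Longrightarrow> entire_series b \<Longrightarrow> entire_series (\<lambda>n. a n + b n)"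
  unfolding entire_series_def by (auto simp: distrib_right intro: summable_add)

lemma entire_series_cmult: "entire_series a \<Longrightarrow> entire_series (\<lambda>n. c * a n)"
  unfolding entire_series_def by (auto simp: mult.assoc intro: summable_mult)

lemma powser_add:
  "entire_series a \<Longrightarrow> entire_series b \<Longrightarrow> powser (\<lambda>n. a n + b n) u = powser a u + powser b u"
  by (intro powser_unique) (auto simp: distrib_right intro: sums_add powser_sums)

lemma powser_cmult: "entire_series a \<Longrightarrow> powser (\<lambda>n. c * a n) u = c * powser a u"
  by (intro powser_unique) (auto simp: mult.assoc intro: sums_mult powser_sums)

text \<open>The operator \<open>z d/dz\<close> multiplies the \<open>n\<close>-th coefficient by \<open>n\<close>; it is the source of the factors
  \<open>p + 2 n\<close> in the recurrences below.\<close>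

lemma sums_euler_operator:
  assumes "entire_series a"
  shows "(\<lambda>n. of_nat n * a n * z ^ n) sums (z * (\<Sum>n. diffs a n * z ^ n))"
proof -
  have "(\<lambda>n. z * (of_nat n * a n * z ^ (n - Suc 0))) sums (z * (\<Sum>n. diffs a n * z ^ n))"
    using entire_series_diffs[OF assms] by (intro sums_mult diffs_equiv) (simp add: entire_series_def)
  moreover have "z * (of_nat n * a n * z ^ (n - Suc 0)) = of_nat n * a n * z ^ n" for n
    by (cases n) auto
  ultimately show ?thesis
    by simp
qed

lemma entire_series_euler: "entire_series a \<Longrightarrow> entire_series (\<lambda>n. of_nat n * a n)"
  unfolding entire_series_def[of "\<lambda>n. of_nat n * a n"]
  by (rule allI, rule sums_summable, rule sums_euler_operator)

lemma powser_euler: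
  "entire_series a \<Longrightarrow> powser (\<lambda>n. of_nat n * a n) u = of_real u * powser (diffs a) u"
  by (intro powser_unique) (simp add: sums_euler_operator powser_def)

text \<open>Zeros at all positive reals accumulate at the origin, so the identity theorem for power series
  applies.\<close>

lemma powser_eq_0D:
  assumes a: "entire_series a" and 0: "\<And>u. u > 0 \<Longrightarrow> powser a u = 0"
  shows "a = (\<lambda>_. 0)"
proof
  fix m
  let ?f = "\<lambda>z. \<Sum>n. a n * z ^ n"
  have sm: "(\<lambda>n. a n * (z - 0) ^ n) sums ?f z" for z
    using a by (simp add: entire_series_def summable_sums)
  have "(powser a \<longlongrightarrow> powser a 0) (at 0)"
    using has_vector_derivative_continuous[OF powser_has_vector_derivative[OF a, of 0]]
    by (simp add: isCont_def)
  then have "(powser a \<longlongrightarrow> powser a 0) (at_right 0)"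
    by (rule tendsto_within_subset) simp
  moreover have "(powser a \<longlongrightarrow> 0) (at_right 0)"
    by (rule tendsto_eventually, rule eventually_at_rightI[of 0 1]) (simp_all add: 0)
  ultimately have z: "powser a 0 = 0"
    by (rule tendsto_unique[OF trivial_limit_at_right_real])
  show "a m = 0"
  proof (rule ccontr)
    assume m: "a m \<noteq> 0"
    have "m > 0"
      using z m by (cases m) (auto simp: powser_def)
    moreover have "?f 0 = 0"
      using z by (simp add: powser_def)
    ultimately obtain t where "t > 0" and t: "\<And>z. z \<in> cball 0 t - {0} \<Longrightarrow> ?f z \<noteq> 0"
      using powser_0_nonzero[of 1 0 a ?f m, OF zero_less_one sm _ m] by metis
    show False
      using t[of "of_real t"] 0[of t] \<open>t > 0\<close> by (simp add: powser_def)
  qed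
qed

text \<open>Termwise convergence to zero at every radius is enough, by comparison with a geometric series at
  a larger radius.  So only the individual terms of a convergent Clifford-valued series need to be
  controlled.\<close>

lemma entire_seriesI:
  assumes "\<And>u. u > 0 \<Longrightarrow> (\<lambda>n. a n * of_real u ^ n) \<longlonglongrightarrow> 0"
  shows "entire_series a"
  unfolding entire_series_def
proof
  fix z :: complex
  define u where "u = norm z + 1"
  have u: "u > 0" "norm z < u"
    by (auto simp: u_def add_nonneg_pos)
  have "Bseq (\<lambda>n. a n * of_real u ^ n)"
    using assms[OF u(1)] by (intro convergent_imp_Bseq convergentI)
  then obtain M where "\<And>n. norm (a n * of_real u ^ n) \<le> M"
    by (auto simp: Bseq_def)
  then have "\<And>n. norm (a n) * u ^ n \<le> M"
    using u by (simp add: norm_mult norm_power)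
  then have "summable (\<lambda>n. norm (a n) * norm z ^ n)"
    using u by (intro Abel_lemma[of _ u]) auto
  then show "summable (\<lambda>n. a n * z ^ n)"
    using summable_norm_cancel[of "\<lambda>n. a n * z ^ n"] by (simp add: norm_mult norm_power)
qed

section \<open>Monogenicity as a system of recurrences\<close>

text \<open>By linear independence the wave is annihilated exactly when the four scalar power series produced
  by the Dirac operator vanish for \<open>u > 0\<close>, that is, when all their coefficients \<open>R1\<close>, \<open>R2\<close>, \<open>R3\<close>,
  \<open>R4\<close> vanish.  The resulting recurrences decouple into one for \<open>(A, K)\<close> and one for \<open>(G, H)\<close>.\<close>

lemma monogenic_radial_powser_iff:
  fixes s :: "real ^ 'q"
  assumes s: "norm s = 1"
    and ent: "entire_series A" "entire_series G" "entire_series H" "entire_series K"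
  defines "p \<equiv> of_nat CARD('p) :: complex"
  shows "monogenic (radial_wave s (powser A) (powser G) (powser H) (powser K)
      :: (real ^ 'p) \<times> (real ^ 'q) \<Rightarrow> ('p::finite + 'q::finite) clifford) \<longleftrightarrow>
    (\<forall>n. (p + 2 * of_nat n) * G n = - H n \<and> 2 * of_nat (Suc n) * A (Suc n) = - K n \<and>
      (p + 2 * of_nat n) * K n = A n \<and> 2 * of_nat (Suc n) * H (Suc n) = G n)"
proof -
  let ?W = "radial_wave s (powser A) (powser G) (powser H) (powser K)
      :: (real ^ 'p) \<times> (real ^ 'q) \<Rightarrow> ('p + 'q) clifford"
  \<comment> \<open>The differences are written as sums of multiples, so that the linearity rules for
    \<^const>\<open>powser\<close> apply as they stand.\<close>
  define R1 where "R1 = (\<lambda>n. (- p) * G n + ((- 2) * (of_nat n * G n) + (- 1) * H n))"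
  define R2 where "R2 = (\<lambda>n. 2 * diffs A n + K n)"
  define R3 where "R3 = (\<lambda>n. A n + ((- p) * K n + (- 2) * (of_nat n * K n)))"
  define R4 where "R4 = (\<lambda>n. 2 * diffs H n + (- 1) * G n)"
  note ents = entire_series_add entire_series_cmult entire_series_euler entire_series_diffs ent
  have R: "entire_series R1" "entire_series R2" "entire_series R3" "entire_series R4"
    unfolding R1_def R2_def R3_def R4_def by (intro ents)+
  have pw: "powser R1 u = (- p) * powser G u + ((- 2) * (of_real u * powser (diffs G) u) + (- 1) * powser H u)"
    "powser R2 u = 2 * powser (diffs A) u + powser K u"
    "powser R3 u = powser A u + ((- p) * powser K u + (- 2) * (of_real u * powser (diffs K) u))"
    "powser R4 u = 2 * powser (diffs H) u + (- 1) * powser G u" for u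
    unfolding R1_def R2_def R3_def R4_def by (simp_all only: powser_add powser_cmult powser_euler ents)
  have dirac: "dirac_x ?W z + dirac_y ?W z = radial_wave s (powser R1) (powser R2) (powser R3) (powser R4) z" for z
    unfolding dirac_radial_wave[OF s ent[THEN powser_has_vector_derivative]]
    by (rule arg_cong[of _ _ "\<lambda>w. w z"], rule arg_cong4[of _ _ _ _ _ _ _ _ "radial_wave s"])
      (simp_all add: fun_eq_iff pw p_def)
  have "?W differentiable (at z)" for z
    using has_derivative_radial_wave[OF ent[THEN powser_has_vector_derivative], where s=s and x="fst z" and y="snd z"]
    by (auto simp: differentiable_def)
  then have "monogenic ?W \<longleftrightarrow>
      (\<forall>z :: (real ^ 'p) \<times> (real ^ 'q). radial_wave s (powser R1) (powser R2) (powser R3) (powser R4) z = (0 :: ('p + 'q) clifford))"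
    by (simp add: monogenic_def dirac)
  also have "\<dots> \<longleftrightarrow> R1 = (\<lambda>_. 0) \<and> R2 = (\<lambda>_. 0) \<and> R3 = (\<lambda>_. 0) \<and> R4 = (\<lambda>_. 0)"
  proof
    assume *: "\<forall>z :: (real ^ 'p) \<times> (real ^ 'q). radial_wave s (powser R1) (powser R2) (powser R3) (powser R4) z = (0 :: ('p + 'q) clifford)"
    have "powser R1 u = 0 \<and> powser R2 u = 0 \<and> powser R3 u = 0 \<and> powser R4 u = 0" if "u > 0" for u
    proof -
      define x :: "real ^ 'p" where "x = axis undefined (sqrt u)"
      have "x \<bullet> x = u"
        using that by (simp add: x_def inner_axis_axis)
      moreover from this that have "x \<noteq> 0"
        by auto
      ultimately show ?thesis
        using *[rule_format, of "(x, 0)"] radial_wave_eq_0_iff[OF s] by metis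
    qed
    then show "R1 = (\<lambda>_. 0) \<and> R2 = (\<lambda>_. 0) \<and> R3 = (\<lambda>_. 0) \<and> R4 = (\<lambda>_. 0)"
      using R by (blast intro: powser_eq_0D)
  qed (simp add: radial_wave_def powser_def)
  also have "\<dots> \<longleftrightarrow> (\<forall>n. R1 n = 0 \<and> R2 n = 0 \<and> R3 n = 0 \<and> R4 n = 0)"
    by (auto simp: fun_eq_iff)
  also have "\<dots> \<longleftrightarrow> (\<forall>n. (p + 2 * of_nat n) * G n = - H n \<and> 2 * of_nat (Suc n) * A (Suc n) = - K n \<and>
      (p + 2 * of_nat n) * K n = A n \<and> 2 * of_nat (Suc n) * H (Suc n) = G n)"
  proof (intro arg_cong[of _ _ All] ext)
    fix n
    have "R1 n = 0 \<longleftrightarrow> (p + 2 * of_nat n) * G n = - H n"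
      unfolding R1_def by (auto simp: algebra_simps add_eq_0_iff)
    moreover have "R2 n = 0 \<longleftrightarrow> 2 * of_nat (Suc n) * A (Suc n) = - K n"
      unfolding R2_def by (simp add: diffs_def eq_neg_iff_add_eq_0 algebra_simps)
    moreover have "R3 n = 0 \<longleftrightarrow> (p + 2 * of_nat n) * K n = A n"
      unfolding R3_def by (auto simp: algebra_simps)
    moreover have "R4 n = 0 \<longleftrightarrow> 2 * of_nat (Suc n) * H (Suc n) = G n"
      unfolding R4_def by (auto simp: diffs_def algebra_simps)
    ultimately show "(R1 n = 0 \<and> R2 n = 0 \<and> R3 n = 0 \<and> R4 n = 0) = 
      ((p + 2 * of_nat n) * G n = - H n \<and> 2 * of_nat (Suc n) * A (Suc n) = - K n \<and>
      (p + 2 * of_nat n) * K n = A n \<and> 2 * of_nat (Suc n) * H (Suc n) = G n)"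
      by simp
  qed
  finally show ?thesis .
qed

section \<open>Plane wave series in powers of the vector x\<close>

lemma limseq_even_odd:
  assumes "(\<lambda>n. X (2 * n)) \<longlonglongrightarrow> l" "(\<lambda>n. X (2 * n + 1)) \<longlonglongrightarrow> l"
  shows "X \<longlonglongrightarrow> l"
  unfolding filterlim_iff
proof (intro allI impI)
  fix P assume "\<forall>\<^sub>F x in nhds l. P x"
  with assms have "\<forall>\<^sub>F n in sequentially. P (X (2 * n))" "\<forall>\<^sub>F n in sequentially. P (X (2 * n + 1))"
    unfolding filterlim_iff by blast+
  then have "\<forall>\<^sub>F n in sequentially. P (X (2 * n)) \<and> P (X (2 * n + 1))"
    by (rule eventually_conj)
  then obtain N where N: "\<And>n. n \<ge> N \<Longrightarrow> P (X (2 * n)) \<and> P (X (2 * n + 1))"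
    unfolding eventually_sequentially by blast
  have "P (X n)" if "n \<ge> 2 * N" for n
  proof (cases "even n")
    case True
    then have "n = 2 * (n div 2)" by simp
    then show ?thesis using N[of "n div 2"] that by (metis div_le_mono nonzero_mult_div_cancel_left zero_neq_numeral)
  next
    case False
    then have "n = 2 * (n div 2) + 1" by simp
    then show ?thesis using N[of "n div 2"] that by (metis div_le_mono nonzero_mult_div_cancel_left zero_neq_numeral)
  qed
  then show "\<forall>\<^sub>F n in sequentially. P (X n)"
    unfolding eventually_sequentially by blast
qed

lemma sums_even_odd:
  fixes f :: "nat \<Rightarrow> 'a::real_normed_vector"
  assumes "(\<lambda>n. f (2 * n)) sums a" "(\<lambda>n. f (2 * n + 1)) sums b"
  shows "f sums (a + b)"
proof -
  have split: "sum f {..<2 * n} = (\<Sum>i<n. f (2 * i)) + (\<Sum>i<n. f (2 * i + 1))" for n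
    by (induction n) (auto simp: algebra_simps)
  have even: "(\<lambda>n. sum f {..<2 * n}) \<longlonglongrightarrow> a + b"
    unfolding split using assms by (auto simp: sums_def intro: tendsto_add)
  have "(\<lambda>n. f (2 * n)) \<longlonglongrightarrow> 0"
    using assms(1) by (intro summable_LIMSEQ_zero) (rule sums_summable)
  from tendsto_add[OF even this] have "(\<lambda>n. sum f {..<2 * n + 1}) \<longlonglongrightarrow> a + b"
    by simp
  with even show ?thesis
    unfolding sums_def by (rule limseq_even_odd)
qed

lemma xvec_power_even: "xvec x ^ (2 * n) = of_real ((- (x \<bullet> x)) ^ n)"
  by (simp add: power_mult power2_eq_square xvec_square)

text \<open>Even powers of \<open>xvec x\<close> are scalars, and odd powers are scalar multiples of \<open>xvec x\<close>.  Hence the terms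
  of a plane wave series of even and of odd index form power series in \<open>x \<bullet> x\<close>, and the signs
  \<open>(-1) ^ n\<close> are absorbed into their coefficients.\<close>

lemma even_term:
  fixes s :: "real ^ 'q::finite" and x :: "real ^ 'p::finite"
  shows "xvec x ^ (2 * n) * (scalar c + yvec s * scalar d) =
   scalar ((-1) ^ n * c * of_real (x \<bullet> x) ^ n) + scalar ((-1) ^ n * d * of_real (x \<bullet> x) ^ n) * yvec s"
proof -
  have e: "(of_real ((- (x \<bullet> x)) ^ n) :: ('p + 'q) clifford) = scalar ((-1) ^ n * of_real (x \<bullet> x) ^ n)"
    by (simp add: scalar_mult scalar_power scalar_of_real) (rule power_minus)
  have "(-1) ^ n * a * of_real (x \<bullet> x) ^ n = (-1) ^ n * of_real (x \<bullet> x) ^ n * a" for a :: complex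
    by simp
  then show ?thesis
    unfolding xvec_power_even e
    by (simp only: distrib_left scalar_commute[of "yvec s"] scalar_mult mult.assoc)
qed

lemma odd_term:
  fixes s :: "real ^ 'q::finite" and x :: "real ^ 'p::finite"
  shows "xvec x ^ (2 * n + 1) * (scalar c + yvec s * scalar d) =
   xvec x * (scalar ((-1) ^ n * c * of_real (x \<bullet> x) ^ n) + scalar ((-1) ^ n * d * of_real (x \<bullet> x) ^ n) * yvec s)"
proof -
  have "xvec x ^ (2 * n + 1) * v = xvec x * (xvec x ^ (2 * n) * v)" for v :: "('p + 'q) clifford"
    by (simp add: mult.assoc)
  then show ?thesis
    by (simp only: even_term)
qed

lemma exp_plane_wave_series_radial_wave:
  fixes s :: "real ^ 'q::finite" and x :: "real ^ 'p::finite"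
  assumes "entire_series (\<lambda>n. (-1) ^ n * c (2 * n))" "entire_series (\<lambda>n. (-1) ^ n * c (2 * n + 1))"
    "entire_series (\<lambda>n. (-1) ^ n * d (2 * n))" "entire_series (\<lambda>n. (-1) ^ n * d (2 * n + 1))"
  shows "exp_plane_wave_series c d s (radial_wave s
      (powser (\<lambda>n. (-1) ^ n * c (2 * n))) (powser (\<lambda>n. (-1) ^ n * c (2 * n + 1)))
      (powser (\<lambda>n. (-1) ^ n * d (2 * n))) (powser (\<lambda>n. (-1) ^ n * d (2 * n + 1)))
      :: (real ^ 'p) \<times> (real ^ 'q) \<Rightarrow> ('p + 'q) clifford)"
  unfolding exp_plane_wave_series_def
proof (intro allI)
  fix x :: "real ^ 'p" and y :: "real ^ 'q"
  note scalar_sums = bounded_linear.sums[OF bounded_linear_scalar powser_sums]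
  note left = bounded_linear.sums[OF clifford_mult.bounded_linear_right]
  note right = bounded_linear.sums[OF clifford_mult.bounded_linear_left]
  show "(\<lambda>j. xvec x ^ j * (scalar (c j) + yvec s * scalar (d j)) * scalar (of_real (exp (y \<bullet> s)))) sums
    radial_wave s
      (powser (\<lambda>n. (-1) ^ n * c (2 * n))) (powser (\<lambda>n. (-1) ^ n * c (2 * n + 1)))
      (powser (\<lambda>n. (-1) ^ n * d (2 * n))) (powser (\<lambda>n. (-1) ^ n * d (2 * n + 1))) (x, y)"
    unfolding radial_wave_def prod.case
  proof (rule right)
    let ?a = "scalar (powser (\<lambda>n. (-1) ^ n * c (2 * n)) (x \<bullet> x)) + scalar (powser (\<lambda>n. (-1) ^ n * d (2 * n)) (x \<bullet> x)) * yvec s"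
    let ?b = "xvec x * (scalar (powser (\<lambda>n. (-1) ^ n * c (2 * n + 1)) (x \<bullet> x)) + scalar (powser (\<lambda>n. (-1) ^ n * d (2 * n + 1)) (x \<bullet> x)) * yvec s)"
    have "(\<lambda>j. xvec x ^ j * (scalar (c j) + yvec s * scalar (d j))) sums (?a + ?b)"
    proof (rule sums_even_odd)
      show "(\<lambda>n. xvec x ^ (2 * n) * (scalar (c (2 * n)) + yvec s * scalar (d (2 * n)))) sums ?a"
        unfolding even_term
          by (rule sums_add[OF scalar_sums[OF assms(1)] right[OF scalar_sums[OF assms(3)]]])
      show "(\<lambda>n. xvec x ^ (2 * n + 1) * (scalar (c (2 * n + 1)) + yvec s * scalar (d (2 * n + 1)))) sums ?b"
        unfolding odd_term
          by (rule left[OF sums_add[OF scalar_sums[OF assms(2)] right[OF scalar_sums[OF assms(4)]]]])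
    qed
    then show "(\<lambda>j. xvec x ^ j * (scalar (c j) + yvec s * scalar (d j))) sums
      (scalar (powser (\<lambda>n. (-1) ^ n * c (2 * n)) (x \<bullet> x)) + xvec x * scalar (powser (\<lambda>n. (-1) ^ n * c (2 * n + 1)) (x \<bullet> x)) +
      (scalar (powser (\<lambda>n. (-1) ^ n * d (2 * n)) (x \<bullet> x)) + xvec x * scalar (powser (\<lambda>n. (-1) ^ n * d (2 * n + 1)) (x \<bullet> x))) * yvec s)"
      by (simp add: distrib_left distrib_right mult.assoc add_ac)
  qed
qed

lemma blade_coeff_yvec:
  fixes s :: "real ^ 'q::finite"
  shows "blade_coeff (yvec s :: ('p::finite + 'q) clifford) {} = 0"
proof -
  have "blade_coeff (yvec s :: ('p + 'q) clifford) {} = (\<Sum>j\<in>UNIV. blade_coeff ((s $ j) *\<^sub>R gen (Inr j) :: ('p + 'q) clifford) {})"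
    unfolding yvec_def by (rule linear_sum[OF bounded_linear.linear[OF bounded_linear_blade_coeff]])
  then show ?thesis
    by (simp add: gen_def blade_def axis_def)
qed

text \<open>Convergence of the Clifford-valued series at every point forces its four scalar parts to
  converge everywhere.  The terms of the series tend to zero, and the coefficient of the empty
  blade, taken before and after a right multiplication by \<open>S\<close>, isolates the parts \<open>c j\<close> and \<open>d j\<close>.
  At odd index a left multiplication by \<open>X\<close> first turns the factor \<open>X\<close> into the scalar \<open>- u\<close>.\<close>

lemma entire_series_of_exp_plane_wave:
  fixes s :: "real ^ 'q::finite" and F :: "(real ^ 'p::finite) \<times> (real ^ 'q) \<Rightarrow> ('p + 'q) clifford"
  assumes s: "norm s = 1" and F: "exp_plane_wave_series c d s F"
  shows "entire_series (\<lambda>n. (-1) ^ n * c (2 * n))" "entire_series (\<lambda>n. (-1) ^ n * c (2 * n + 1))"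
    "entire_series (\<lambda>n. (-1) ^ n * d (2 * n))" "entire_series (\<lambda>n. (-1) ^ n * d (2 * n + 1))"
proof -
  have "(\<lambda>n. (-1) ^ n * c (2 * n) * of_real u ^ n) \<longlonglongrightarrow> 0 \<and> (\<lambda>n. (-1) ^ n * c (2 * n + 1) * of_real u ^ n) \<longlonglongrightarrow> 0 \<and>
    (\<lambda>n. (-1) ^ n * d (2 * n) * of_real u ^ n) \<longlonglongrightarrow> 0 \<and> (\<lambda>n. (-1) ^ n * d (2 * n + 1) * of_real u ^ n) \<longlonglongrightarrow> 0"
    if u: "u > 0" for u
  proof -
    define x :: "real ^ 'p" where "x = axis undefined (sqrt u)"
    define X :: "('p + 'q) clifford" where "X = xvec x"
    define S :: "('p + 'q) clifford" where "S = yvec s"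
    have x: "x \<bullet> x = u"
      using that by (simp add: x_def inner_axis_axis)
    have XX: "X * (X * v) = (- u) *\<^sub>R v" for v
      by (simp add: X_def mult.assoc[symmetric] xvec_square x) (simp add: of_real_def)
    have SS: "S * S = -1"
      using s by (simp add: S_def yvec_square norm_eq_1)
    define V where "V = (\<lambda>j. xvec x ^ j * (scalar (c j) + yvec s * scalar (d j)) :: ('p + 'q) clifford)"
    have "(\<lambda>j. V j * scalar (of_real (exp ((0 :: real ^ 'q) \<bullet> s)))) sums F (x, 0)"
      using F unfolding exp_plane_wave_series_def V_def by blast
    then have "V sums F (x, 0)"
      by simp
    then have V: "V \<longlonglongrightarrow> 0"
      by (intro summable_LIMSEQ_zero) (rule sums_summable)
    have coeff0: "(\<lambda>n. a n * of_real u ^ n) \<longlonglongrightarrow> 0 \<and> (\<lambda>n. b n * of_real u ^ n) \<longlonglongrightarrow> 0"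
      if "(\<lambda>n. scalar (a n * of_real u ^ n) + scalar (b n * of_real u ^ n) * S) \<longlonglongrightarrow> 0" for a b
    proof -
      note bc = bounded_linear.tendsto_zero[OF bounded_linear_blade_coeff[of "{}"]]
      from bc[OF that] have "(\<lambda>n. a n * of_real u ^ n) \<longlonglongrightarrow> 0"
        by (simp add: blade_coeff_scalar blade_coeff_scalar_mult S_def blade_coeff_yvec)
      moreover from bc[OF bounded_linear.tendsto_zero[OF clifford_mult.bounded_linear_left[of S] that]]
      have "(\<lambda>n. - (b n * of_real u ^ n)) \<longlonglongrightarrow> 0"
        by (simp add: distrib_right mult.assoc SS blade_coeff_scalar blade_coeff_scalar_mult)
          (simp add: S_def blade_coeff_yvec)
      then have "(\<lambda>n. b n * of_real u ^ n) \<longlonglongrightarrow> 0"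
        using tendsto_minus by fastforce
      ultimately show ?thesis ..
    qed
    have "(\<lambda>n. V (2 * n)) \<longlonglongrightarrow> 0"
      using LIMSEQ_subseq_LIMSEQ[OF V, of "\<lambda>n. 2 * n"] by (simp add: strict_mono_def o_def)
    from this[unfolded V_def even_term x, folded S_def]
    have "(\<lambda>n. (-1) ^ n * c (2 * n) * of_real u ^ n) \<longlonglongrightarrow> 0 \<and> (\<lambda>n. (-1) ^ n * d (2 * n) * of_real u ^ n) \<longlonglongrightarrow> 0"
      by (rule coeff0)
    moreover have "(\<lambda>n. V (2 * n + 1)) \<longlonglongrightarrow> 0"
      using LIMSEQ_subseq_LIMSEQ[OF V, of "\<lambda>n. 2 * n + 1"] by (simp add: strict_mono_def o_def)
    from bounded_linear.tendsto_zero[OF clifford_mult.bounded_linear_right[of X]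
        this[unfolded V_def odd_term x, folded S_def X_def]]
    have "(\<lambda>n. (- u) *\<^sub>R (scalar ((-1) ^ n * c (2 * n + 1) * of_real u ^ n) + scalar ((-1) ^ n * d (2 * n + 1) * of_real u ^ n) * S)) \<longlonglongrightarrow> 0"
      by (simp only: XX)
    from tendsto_scaleR[OF tendsto_const[of "- inverse u"] this] u
    have "(\<lambda>n. scalar ((-1) ^ n * c (2 * n + 1) * of_real u ^ n) + scalar ((-1) ^ n * d (2 * n + 1) * of_real u ^ n) * S) \<longlonglongrightarrow> 0"
      by (simp add: add.commute)
    then have "(\<lambda>n. (-1) ^ n * c (2 * n + 1) * of_real u ^ n) \<longlonglongrightarrow> 0 \<and> (\<lambda>n. (-1) ^ n * d (2 * n + 1) * of_real u ^ n) \<longlonglongrightarrow> 0"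
      by (rule coeff0)
    ultimately show ?thesis
      by simp
  qed
  then show "entire_series (\<lambda>n. (-1) ^ n * c (2 * n))" "entire_series (\<lambda>n. (-1) ^ n * c (2 * n + 1))"
    "entire_series (\<lambda>n. (-1) ^ n * d (2 * n))" "entire_series (\<lambda>n. (-1) ^ n * d (2 * n + 1))"
    by (blast intro: entire_seriesI)+
qed

section \<open>The Bessel coefficients\<close>

text \<open>
  These are the coefficients in powers of \<open>r\<^sup>2\<close> of
  \<open>Gamma \<mu> * (2 / r) powr (\<mu> - 1) * J (\<mu> - 1) r\<close>, normalised so that the first one is \<open>1\<close>.
\<close>

definition bessel_coeff :: "real \<Rightarrow> nat \<Rightarrow> complex"
  where "bessel_coeff \<mu> n = (-1) ^ n / (4 ^ n * fact n * pochhammer (of_real \<mu>) n)"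

lemma pochhammer_of_real_nonzero: "\<mu> > 0 \<Longrightarrow> pochhammer (of_real \<mu> :: complex) n \<noteq> 0"
  by (metis of_real_0 of_real_eq_iff pochhammer_of_real pochhammer_pos less_irrefl)

lemma bessel_coeff_Suc:
  "bessel_coeff \<mu> (Suc n) = - bessel_coeff \<mu> n / (4 * of_nat (Suc n) * (of_real \<mu> + of_nat n))"
  by (simp add: bessel_coeff_def pochhammer_Suc mult_ac del: of_nat_Suc)

lemma bessel_coeff_shift:
  assumes "\<mu> > 0"
  shows "(of_real \<mu> + of_nat n) * bessel_coeff (\<mu> + 1) n = of_real \<mu> * bessel_coeff \<mu> n"
proof -
  have "of_real \<mu> * pochhammer (of_real (\<mu> + 1)) n = pochhammer (of_real \<mu>) n * (of_real \<mu> + of_nat n :: complex)"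
    using pochhammer_rec[of "of_real \<mu> :: complex" n] by (simp add: pochhammer_Suc)
  moreover have "pochhammer (of_real \<mu> :: complex) n \<noteq> 0" "pochhammer (of_real (\<mu> + 1) :: complex) n \<noteq> 0"
    using assms by (simp_all only: pochhammer_of_real_nonzero add_pos_pos zero_less_one not_False_eq_True)
  ultimately show ?thesis
    by (simp add: bessel_coeff_def divide_simps)
qed

text \<open>The ratio of consecutive terms has norm \<open>norm z / (4 (n + 1) (\<mu> + n))\<close>, which is at most \<open>1 / 2\<close> as
  soon as \<open>norm z \<le> n\<close>.\<close>

lemma entire_bessel_coeff:
  assumes "\<mu> > 0"
  shows "entire_series (bessel_coeff \<mu>)"
  unfolding entire_series_def
proof
  fix z :: complex
  define N where "N = nat \<lceil>norm z\<rceil>"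
  show "summable (\<lambda>n. bessel_coeff \<mu> n * z ^ n)"
  proof (rule summable_ratio_test[of "1 / 2" N])
    fix n assume n: "n \<ge> N"
    have pos: "\<mu> + real n > 0"
      using assms by simp
    have "norm z \<le> real n"
      using n unfolding N_def by linarith
    also have "real n \<le> 2 * real (Suc n) * (\<mu> + real n)"
    proof (cases "n = 0")
      case False
      then have "1 * real n \<le> (2 * real (Suc n)) * (\<mu> + real n)"
        using assms by (intro mult_mono) auto
      then show ?thesis by simp
    qed (use assms in simp)
    finally have "norm z / (4 * real (Suc n) * (\<mu> + real n)) \<le> 1 / 2"
      using pos by (subst pos_divide_le_eq) (simp, linarith)
    have nrm: "norm (of_real \<mu> + of_nat n :: complex) = \<mu> + real n"
      using pos by (metis abs_of_pos norm_of_real of_real_add of_real_of_nat_eq)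
    have "norm (bessel_coeff \<mu> (Suc n) * z ^ Suc n) =
        norm z / (4 * real (Suc n) * (\<mu> + real n)) * norm (bessel_coeff \<mu> n * z ^ n)"
      unfolding bessel_coeff_Suc norm_mult norm_divide norm_minus_cancel nrm norm_of_nat norm_power
      by simp
    also have "\<dots> \<le> 1 / 2 * norm (bessel_coeff \<mu> n * z ^ n)"
      by (rule mult_right_mono) (fact, simp)
    finally show "norm (bessel_coeff \<mu> (Suc n) * z ^ Suc n) \<le> 1 / 2 * norm (bessel_coeff \<mu> n * z ^ n)" .
  qed simp
qed

text \<open>The initial value \<open>H 0 = 0\<close> propagates through the system for \<open>(G, H)\<close> and makes it vanish, while
  eliminating \<open>K\<close> from the system for \<open>(A, K)\<close> leaves the first-order recurrence of the Bessel
  coefficients.  The denominators are nonzero because \<open>\<mu> > 0\<close>.\<close>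

lemma recurrence_unique:
  fixes \<mu> :: real and A G H K :: "nat \<Rightarrow> complex"
  assumes \<mu>: "\<mu> > 0" and init: "A 0 = 1" "H 0 = 0"
  shows "(\<forall>n. (2 * of_real \<mu> + 2 * of_nat n) * G n = - H n \<and> 2 * of_nat (Suc n) * A (Suc n) = - K n \<and>
      (2 * of_real \<mu> + 2 * of_nat n) * K n = A n \<and> 2 * of_nat (Suc n) * H (Suc n) = G n) \<longleftrightarrow>
    A = bessel_coeff \<mu> \<and> G = (\<lambda>_. 0) \<and> H = (\<lambda>_. 0) \<and> K = (\<lambda>n. bessel_coeff (\<mu> + 1) n / (2 * of_real \<mu>))"
    (is "?L \<longleftrightarrow> ?R")
proof -
  have nz: "2 * of_real \<mu> + 2 * of_nat n \<noteq> (0 :: complex)" "of_real \<mu> + of_nat n \<noteq> (0 :: complex)" for n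
  proof -
    have "\<mu> + real n \<noteq> 0"
      using \<mu> by linarith
    then have "complex_of_real (\<mu> + real n) \<noteq> 0"
      by (simp only: of_real_eq_0_iff not_False_eq_True)
    then show "of_real \<mu> + of_nat n \<noteq> (0 :: complex)"
      by simp
    then have "2 * (of_real \<mu> + of_nat n) \<noteq> (0 :: complex)"
      by (metis mult_eq_0_iff zero_neq_numeral)
    then show "2 * of_real \<mu> + 2 * of_nat n \<noteq> (0 :: complex)"
      unfolding distrib_left .
  qed
  have shift: "bessel_coeff (\<mu> + 1) n / (2 * of_real \<mu>) = bessel_coeff \<mu> n / (2 * of_real \<mu> + 2 * of_nat n)" for n
  proof -
    have "2 * ((of_real \<mu> + of_nat n) * bessel_coeff (\<mu> + 1) n) = 2 * (of_real \<mu> * bessel_coeff \<mu> n)"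
      by (simp only: bessel_coeff_shift[OF \<mu>])
    then show ?thesis
      using \<mu> nz(1)[of n] by (subst frac_eq_eq) (simp_all add: algebra_simps)
  qed
  have step: "2 * of_nat (Suc n) * bessel_coeff \<mu> (Suc n) = - (bessel_coeff \<mu> n / (2 * of_real \<mu> + 2 * of_nat n))" for n
  proof -
    have "of_nat (Suc n) \<noteq> (0 :: complex)"
      by (simp only: of_nat_eq_0_iff)
    moreover have "2 * m * (- b / (4 * m * w)) = - (b / (2 * w))" if "m \<noteq> 0" "w \<noteq> 0" for m w b :: complex
      using that by (simp add: divide_simps)
    moreover have "2 * of_real \<mu> + 2 * of_nat n = 2 * (of_real \<mu> + of_nat n :: complex)"
      by (simp only: distrib_left)
    ultimately show ?thesis
      unfolding bessel_coeff_Suc using nz(2)[of n] by metis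
  qed
  show ?thesis
  proof
    assume L: ?L
    have K: "K n = A n / (2 * of_real \<mu> + 2 * of_nat n)" for n
      using L nz(1)[of n] by (simp add: eq_divide_eq mult.commute)
    have A: "A n = bessel_coeff \<mu> n" for n
    proof (induction n)
      case 0
      then show ?case by (simp add: init bessel_coeff_def)
    next
      case (Suc n)
      have "2 * of_nat (Suc n) * A (Suc n) = 2 * of_nat (Suc n) * bessel_coeff \<mu> (Suc n)"
        using L K[of n] Suc step[of n] by metis
      then show ?case
        by (simp del: of_nat_Suc)
    qed
    have H: "H n = 0" for n
    proof (induction n)
      case (Suc n)
      then have "G n = 0"
        using L nz(1)[of n] by (metis mult_eq_0_iff neg_equal_0_iff_equal)
      then have "2 * of_nat (Suc n) * H (Suc n) = 0"
        using L by metis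
      then show ?case
        by (simp del: of_nat_Suc)
    qed (rule init)
    have G: "G n = 0" for n
      using L H nz(1)[of n] by (metis mult_eq_0_iff neg_equal_0_iff_equal)
    show ?R
      unfolding shift by (auto simp: A G H K)
  next
    assume R: ?R
    show ?L
      unfolding R[THEN conjunct1] shift R[THEN conjunct2, THEN conjunct1] R[THEN conjunct2, THEN conjunct2, THEN conjunct1]
        R[THEN conjunct2, THEN conjunct2, THEN conjunct2] step
      using nz by simp
  qed
qed

text \<open>The quotient \<open>Gamma (\<mu> + j) / Gamma \<mu>\<close> is a Pochhammer symbol, so the power of \<open>r\<close> and the value
  \<open>Gamma \<mu>\<close> factor out of the Bessel series.  The case \<open>\<mu> = 1\<close> of order zero is covered because
  \<open>(r / 2) powr 0 = 1\<close> for \<open>r > 0\<close>.\<close>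

lemma Bessel_J_powser:
  assumes \<mu>: "\<mu> > 0" and r: "r > 0"
  shows "Bessel_J (of_real (\<mu> - 1)) (of_real r) =
    of_real ((r / 2) powr (\<mu> - 1) / Gamma \<mu>) * powser (bessel_coeff \<mu>) (r\<^sup>2)"
proof -
  have summand: "(-1) ^ j * of_real r ^ (2 * j) / (fact j * 2 ^ (2 * j) * Gamma (of_real (\<mu> - 1) + of_nat j + 1)) =
      1 / of_real (Gamma \<mu>) * (bessel_coeff \<mu> j * of_real (r\<^sup>2) ^ j)" for j
  proof -
    have "of_real \<mu> \<notin> (\<int>\<^sub>\<le>\<^sub>0 :: complex set)"
    proof
      assume "of_real \<mu> \<in> (\<int>\<^sub>\<le>\<^sub>0 :: complex set)"
      then obtain n :: int where "of_real \<mu> = (of_int n :: complex)" and n: "n \<le> 0"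
        by (auto elim: nonpos_Ints_cases)
      then have "\<mu> = of_int n"
        by (metis of_real_eq_iff of_real_of_int_eq)
      with n \<mu> show False
        by simp
    qed
    then have "pochhammer (of_real \<mu>) j = Gamma (of_real \<mu> + of_nat j) / Gamma (of_real \<mu> :: complex)"
      by (rule pochhammer_Gamma)
    moreover have "Gamma (of_real \<mu> :: complex) \<noteq> 0"
      using \<open>of_real \<mu> \<notin> _\<close> by (simp add: Gamma_eq_zero_iff)
    ultimately show ?thesis
      by (simp add: bessel_coeff_def power_mult Gamma_complex_of_real[symmetric])
  qed
  have "(\<Sum>j. (-1) ^ j * of_real r ^ (2 * j) / (fact j * 2 ^ (2 * j) * Gamma (of_real (\<mu> - 1) + of_nat j + 1))) =
      1 / of_real (Gamma \<mu>) * powser (bessel_coeff \<mu>) (r\<^sup>2)"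
    unfolding summand
    by (rule sums_unique[symmetric], rule sums_mult, rule powser_sums, rule entire_bessel_coeff, rule \<mu>)
  moreover have "(if of_real (\<mu> - 1) = (0 :: complex) then 1 else of_real r powr of_real (\<mu> - 1) / 2 powr of_real (\<mu> - 1)) =
      complex_of_real ((r / 2) powr (\<mu> - 1))"
  proof -
    have "(2 :: complex) powr of_real (\<mu> - 1) = of_real (2 powr (\<mu> - 1))"
      using powr_of_real[of 2 "\<mu> - 1"] by simp
    moreover have "of_real r powr of_real (\<mu> - 1) = complex_of_real (r powr (\<mu> - 1))"
      using r by (intro powr_of_real) simp
    ultimately show ?thesis
      using r by (auto simp: powr_divide)
  qed
  ultimately show ?thesis
    unfolding Bessel_J_def by simp
qed

section \<open>The closed form\<close>

text \<open>
  The closed form written with power series in \<open>x \<bullet> x\<close>, which has a meaning at \<open>x = 0\<close> too.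
\<close>

definition entire_bessel_wave ::
    "real ^ 'q \<Rightarrow> (real ^ 'p) \<times> (real ^ 'q) \<Rightarrow> ('p::finite + 'q::finite) clifford"
  where "entire_bessel_wave s = (let \<mu> = real CARD('p) / 2 in
    radial_wave s (powser (bessel_coeff \<mu>)) (powser (\<lambda>_. 0)) (powser (\<lambda>_. 0))
      (powser (\<lambda>n. bessel_coeff (\<mu> + 1) n / (2 * of_real \<mu>))))"

text \<open>The normalising factor \<open>\<gamma>\<close> cancels the prefactor of \<open>J (\<mu> - 1)\<close>.  For \<open>J \<mu>\<close> one more factor
  \<open>r / (2 \<mu>)\<close> remains, from \<open>Gamma (\<mu> + 1) = \<mu> * Gamma \<mu>\<close>; its \<open>r\<close> cancels the normalisation of the
  vector \<open>x\<close>.\<close>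

lemma bessel_wave_formula_eq:
  fixes s :: "real ^ 'q" and x :: "real ^ 'p"
  assumes "x \<noteq> 0"
  shows "bessel_wave_formula s (x, y) = (entire_bessel_wave s (x, y) :: ('p::finite + 'q::finite) clifford)"
proof -
  define \<mu> where "\<mu> = real CARD('p) / 2"
  define r where "r = norm x"
  define a where "a = powser (bessel_coeff \<mu>) (r\<^sup>2)"
  define b where "b = powser (bessel_coeff (\<mu> + 1)) (r\<^sup>2)"
  have \<mu>: "\<mu> > 0" and r: "r > 0"
    using assms by (simp_all add: \<mu>_def r_def)
  define \<gamma> where "\<gamma> = 2 powr (\<mu> - 1) * Gamma \<mu> / r powr (\<mu> - 1)"
  have G: "Gamma \<mu> > 0"
    using \<mu> by (rule Gamma_real_pos)
  have norm_1: "\<gamma> * ((r / 2) powr (\<mu> - 1) / Gamma \<mu>) = 1"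
    using r G by (simp add: \<gamma>_def powr_divide)
  have 1: "\<gamma> *\<^sub>R Bessel_J (of_real (\<mu> - 1)) (of_real r) = a"
    unfolding Bessel_J_powser[OF \<mu> r] a_def scaleR_conv_of_real mult.assoc[symmetric] of_real_mult[symmetric] norm_1
    by simp
  have pw: "(r / 2) powr \<mu> = (r / 2) powr (\<mu> - 1) * (r / 2)"
    using r by (simp add: powr_diff)
  have Gm: "Gamma (\<mu> + 1) = \<mu> * Gamma \<mu>"
    using \<mu> by (intro Gamma_plus1) (auto simp: nonpos_Ints_def)
  have "\<gamma> / r * ((r / 2) powr \<mu> / Gamma (\<mu> + 1)) = \<gamma> * ((r / 2) powr (\<mu> - 1) / Gamma \<mu>) / (2 * \<mu>)"
    unfolding pw Gm using r \<mu> by simp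
  also have "\<dots> = 1 / (2 * \<mu>)"
    by (simp only: norm_1)
  finally have c: "\<gamma> / r * ((r / 2) powr \<mu> / Gamma (\<mu> + 1)) = 1 / (2 * \<mu>)" .
  have "Bessel_J (of_real \<mu>) (of_real r) = of_real ((r / 2) powr \<mu> / Gamma (\<mu> + 1)) * b"
    using Bessel_J_powser[of "\<mu> + 1" r] \<mu> r by (simp add: b_def)
  then have "(\<gamma> / r) *\<^sub>R Bessel_J (of_real \<mu>) (of_real r) = of_real (\<gamma> / r * ((r / 2) powr \<mu> / Gamma (\<mu> + 1))) * b"
    by (simp only: scaleR_conv_of_real mult.assoc[symmetric] of_real_mult[symmetric])
  then have 2: "(\<gamma> / r) *\<^sub>R Bessel_J (of_real \<mu>) (of_real r) = b / (2 * of_real \<mu>)"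
    unfolding c by simp
  have b: "powser (\<lambda>n. bessel_coeff (\<mu> + 1) n / (2 * of_real \<mu>)) (r\<^sup>2) = b / (2 * of_real \<mu>)"
    using powser_cmult[OF entire_bessel_coeff, of "\<mu> + 1" "1 / (2 * of_real \<mu>)"] \<mu> by (simp add: b_def)
  have u: "x \<bullet> x = r\<^sup>2"
    by (simp add: r_def power2_norm_eq_inner)
  have z: "powser (\<lambda>_. 0) u = 0" for u
    by (simp add: powser_def)
  have "bessel_wave_formula s (x, y) =
      (scalar (\<gamma> *\<^sub>R Bessel_J (of_real (\<mu> - 1)) (of_real r))
        + scalar ((\<gamma> / r) *\<^sub>R Bessel_J (of_real \<mu>) (of_real r)) * xvec x * yvec s)
      * (scalar (of_real (exp (y \<bullet> s))) :: ('p + 'q) clifford)"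
    unfolding bessel_wave_formula_def prod.case Let_def \<mu>_def[symmetric] r_def[symmetric] \<gamma>_def[symmetric]
    by (simp add: scalar_scaleR scaleR_right_distrib divide_inverse)
  also have "\<dots> = (scalar a + xvec x * scalar (b / (2 * of_real \<mu>)) * yvec s) * scalar (of_real (exp (y \<bullet> s)))"
    unfolding 1 2 by (simp only: scalar_commute[of "xvec x"])
  also have "\<dots> = entire_bessel_wave s (x, y)"
    unfolding entire_bessel_wave_def Let_def \<mu>_def[symmetric] radial_wave_def prod.case u b z a_def[symmetric]
    by simp
  finally show ?thesis .
qed

lemma entire_series_0: "entire_series (\<lambda>_. 0)"
  by (simp add: entire_series_def)

lemma entire_bessel_wave_coeffs:
  assumes "\<mu> > 0"
  shows "entire_series (\<lambda>n. bessel_coeff (\<mu> + 1) n / (2 * of_real \<mu>))"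
  using entire_series_cmult[OF entire_bessel_coeff, of "\<mu> + 1" "1 / (2 * of_real \<mu>)"] assms by simp

lemma isCont_entire_bessel_wave:
  fixes s :: "real ^ 'q::finite"
  shows "isCont (entire_bessel_wave s :: (real ^ 'p::finite) \<times> (real ^ 'q) \<Rightarrow> ('p + 'q) clifford) (x, y)"
proof -
  define \<mu> where "\<mu> = real CARD('p) / 2"
  have "\<mu> > 0"
    by (simp add: \<mu>_def)
  then show ?thesis
    unfolding entire_bessel_wave_def Let_def \<mu>_def[symmetric]
    by (intro has_derivative_continuous[OF has_derivative_radial_wave[OF
        powser_has_vector_derivative powser_has_vector_derivative
        powser_has_vector_derivative powser_has_vector_derivative]]
      entire_bessel_coeff entire_series_0 entire_bessel_wave_coeffs)
qed

lemma bessel_wave_formula_tendsto: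
  fixes s :: "real ^ 'q::finite"
  shows "((bessel_wave_formula s :: (real ^ 'p::finite) \<times> (real ^ 'q) \<Rightarrow> ('p + 'q) clifford)
    \<longlongrightarrow> entire_bessel_wave s (0, y)) (at (0, y) within {w. fst w \<noteq> 0})"
proof -
  have "((entire_bessel_wave s :: (real ^ 'p) \<times> (real ^ 'q) \<Rightarrow> ('p + 'q) clifford)
      \<longlongrightarrow> entire_bessel_wave s (0, y)) (at (0, y) within {w. fst w \<noteq> 0})"
    using isCont_entire_bessel_wave[where s=s and x=0 and y=y] unfolding isCont_def by (rule tendsto_within_subset) simp
  then show ?thesis
    by (rule Lim_transform_within[of _ _ _ _ 1]) (auto simp: bessel_wave_formula_eq)
qed

text \<open>The limit in the definition of \<^const>\<open>bessel_wave\<close> is determined because \<open>(0, y)\<close> is an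
  accumulation point of the domain of the formula.\<close>

lemma at_0_within_nonzero_neq_bot:
  "at (0 :: real ^ 'p::finite, y :: real ^ 'q::finite) within {w. fst w \<noteq> 0} \<noteq> bot"
proof -
  have "\<exists>w\<in>{w. fst w \<noteq> 0}. w \<noteq> (0, y) \<and> dist w (0 :: real ^ 'p, y) < e" if "e > 0" for e
    using that by (intro bexI[of _ "((e / 2) *\<^sub>R axis undefined 1, y)"]) (auto simp: dist_Pair_Pair norm_axis_1 axis_eq_0_iff)
  then show ?thesis
    by (simp add: trivial_limit_within islimpt_approachable)
qed

text \<open>The closed form is continued to \<open>x = 0\<close> by the power series, which is continuous there.\<close>

lemma bessel_wave_eq:
  "bessel_wave s = (entire_bessel_wave s :: (real ^ 'p) \<times> (real ^ 'q) \<Rightarrow> ('p::finite + 'q::finite) clifford)"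
proof
  fix z :: "(real ^ 'p) \<times> (real ^ 'q)"
  obtain x y where z: "z = (x, y)" by (cases z)
  show "bessel_wave s z = (entire_bessel_wave s z :: ('p + 'q) clifford)"
  proof (cases "x = 0")
    case True
    then show ?thesis
      using tendsto_Lim[OF at_0_within_nonzero_neq_bot bessel_wave_formula_tendsto] by (simp add: z bessel_wave_def)
  next
    case False
    then show ?thesis
      by (simp add: z bessel_wave_def bessel_wave_formula_eq)
  qed
qed

lemma exp_plane_wave_series_unique:
  assumes "exp_plane_wave_series c d s F" "exp_plane_wave_series c d s F'"
  shows "F = F'"
  using assms unfolding exp_plane_wave_series_def by (auto intro!: ext sums_unique2)

text \<open>The profiles of the plane wave are \<open>c j * exp t\<close> and \<open>d j * exp t\<close>.\<close>

lemma hypermonogenic_exp_series: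
  assumes "exp_plane_wave_series c d s F" "monogenic F"
  shows "hypermonogenic_plane_wave s F"
  unfolding hypermonogenic_plane_wave_def
proof (intro conjI exI allI)
  show "(\<lambda>t. c j * of_real (exp t)) differentiable at t" "(\<lambda>t. d j * of_real (exp t)) differentiable at t" for j and t :: real
    unfolding differentiable_def by (rule exI, (rule derivative_intros)+)+
  show "(\<lambda>j. xvec x ^ j * (scalar (c j * of_real (exp (y \<bullet> s))) + yvec s * scalar (d j * of_real (exp (y \<bullet> s))))) sums F (x, y)" for x y
    using assms(1) by (simp add: exp_plane_wave_series_def scalar_mult distrib_left distrib_right mult.assoc)
qed fact

section \<open>The hypermonogenic exponential plane wave\<close>

theorem proposition6p1:
  fixes s :: "real ^ 'q"
  assumes "norm s = 1"
  shows "(\<forall>F :: (real ^ 'p) \<times> (real ^ 'q) \<Rightarrow> ('p + 'q) clifford.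
            (\<exists>c d :: nat \<Rightarrow> complex. c 0 = 1 \<and> d 0 = 0 \<and> exp_plane_wave_series c d s F) \<and>
              hypermonogenic_plane_wave s F
            \<longleftrightarrow> F = bessel_wave s) \<and>
         (\<forall>y. ((bessel_wave_formula s :: (real ^ 'p) \<times> (real ^ 'q) \<Rightarrow> ('p + 'q) clifford)
            \<longlongrightarrow> bessel_wave s (0, y)) (at (0, y) within {w. fst w \<noteq> 0}))"
proof (intro conjI allI iffI)
  define \<mu> where "\<mu> = real CARD('p) / 2"
  have \<mu>: "\<mu> > 0" and p: "of_nat CARD('p) = 2 * complex_of_real \<mu>"
    by (simp_all add: \<mu>_def)
  let ?A = "bessel_coeff \<mu>" and ?K = "\<lambda>n. bessel_coeff (\<mu> + 1) n / (2 * of_real \<mu>)"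
  have wave: "bessel_wave s = (radial_wave s (powser ?A) (powser (\<lambda>_. 0)) (powser (\<lambda>_. 0)) (powser ?K)
      :: (real ^ 'p) \<times> (real ^ 'q) \<Rightarrow> ('p + 'q) clifford)"
    unfolding bessel_wave_eq entire_bessel_wave_def Let_def \<mu>_def ..
  {
    fix F :: "(real ^ 'p) \<times> (real ^ 'q) \<Rightarrow> ('p + 'q) clifford"
    assume *: "(\<exists>c d. c 0 = 1 \<and> d 0 = 0 \<and> exp_plane_wave_series c d s F) \<and> hypermonogenic_plane_wave s F"
    then obtain c d where c0: "c 0 = 1" and d0: "d 0 = 0" and ser: "exp_plane_wave_series c d s F"
      by blast
    let ?a = "\<lambda>n. (-1) ^ n * c (2 * n)" and ?g = "\<lambda>n. (-1) ^ n * c (2 * n + 1)"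
      and ?h = "\<lambda>n. (-1) ^ n * d (2 * n)" and ?k = "\<lambda>n. (-1) ^ n * d (2 * n + 1)"
    note ent = entire_series_of_exp_plane_wave[OF assms ser]
    have F: "F = radial_wave s (powser ?a) (powser ?g) (powser ?h) (powser ?k)"
      by (rule exp_plane_wave_series_unique[OF ser exp_plane_wave_series_radial_wave[OF ent]])
    have "monogenic F"
      using * by (simp add: hypermonogenic_plane_wave_def)
    then have "?a = ?A \<and> ?g = (\<lambda>_. 0) \<and> ?h = (\<lambda>_. 0) \<and> ?k = ?K"
      unfolding F monogenic_radial_powser_iff[OF assms ent] p
      by (subst (asm) recurrence_unique[OF \<mu>]) (simp_all add: c0 d0)
    then show "F = bessel_wave s"
      unfolding F wave by metis
  next
    fix F :: "(real ^ 'p) \<times> (real ^ 'q) \<Rightarrow> ('p + 'q) clifford"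
    assume F: "F = bessel_wave s"
    \<comment> \<open>Only the scalars at even and the multiples of \<open>yvec s\<close> at odd index occur; the signs undo those
      coming from the powers of \<open>xvec x\<close>.\<close>
    define c where "c = (\<lambda>j. if even j then (-1) ^ (j div 2) * ?A (j div 2) else 0)"
    define d where "d = (\<lambda>j. if odd j then (-1) ^ (j div 2) * ?K (j div 2) else 0)"
    have sq: "(-1) ^ n * ((-1) ^ n * w) = w" for n and w :: complex
      by (simp add: mult.assoc[symmetric] power_mult_distrib[symmetric])
    have cd: "(\<lambda>n. (-1) ^ n * c (2 * n)) = ?A" "(\<lambda>n. (-1) ^ n * c (2 * n + 1)) = (\<lambda>_. 0)"
      "(\<lambda>n. (-1) ^ n * d (2 * n)) = (\<lambda>_. 0)" "(\<lambda>n. (-1) ^ n * d (2 * n + 1)) = ?K"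
      by (simp_all add: c_def d_def sq fun_eq_iff)
    note ent = entire_bessel_coeff[OF \<mu>] entire_series_0 entire_series_0 entire_bessel_wave_coeffs[OF \<mu>]
    have ser: "exp_plane_wave_series c d s F"
      using exp_plane_wave_series_radial_wave[of c d s, unfolded cd, OF ent] unfolding F wave .
    moreover have "c 0 = 1" "d 0 = 0"
      by (simp_all add: c_def d_def bessel_coeff_def)
    moreover have "monogenic F"
      unfolding F wave monogenic_radial_powser_iff[OF assms ent] p
      by (subst recurrence_unique[OF \<mu>]) (simp_all add: bessel_coeff_def)
    ultimately show "\<exists>c d. c 0 = 1 \<and> d 0 = 0 \<and> exp_plane_wave_series c d s F" "hypermonogenic_plane_wave s F"
      using hypermonogenic_exp_series by blast+
  next
    fix y
    show "((bessel_wave_formula s :: (real ^ 'p) \<times> (real ^ 'q) \<Rightarrow> ('p + 'q) clifford)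
        \<longlongrightarrow> bessel_wave s (0, y)) (at (0, y) within {w. fst w \<noteq> 0})"
      unfolding bessel_wave_eq by (rule bessel_wave_formula_tendsto)
  }
qed

end
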